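(* Let $K\subseteq F$ be a field extension with $K$ algebraically closed. Let $\mathcal{F},\mathcal{G}\colon\mathbf{alg}_K\to\mathbf{Alg}_K$ be two extension invariant algebra functors and assume that $|K|>\dim_K(\mathcal{F}(K))$ and $|K|>\dim_K(\mathcal{G}(K))$. Then $\mathcal{F}(K)\cong\mathcal{G}(K)$ as $K$-algebras if and only if $\mathcal{F}(F)\cong\mathcal{G}(F)$ as $F$-algebras.
   Context: $\mathbf{alg}_K$ is the category of associative and commutative $K$-algebras with non-zero unit (morphisms are unital $K$-algebra homomorphisms). $\mathbf{Alg}_K$ is the category of all $K$-algebras, not necessarily associative, commutative or unital. A $K$-algebra functor is a functor $\mathcal{F}\colon\mathbf{alg}_K\to\mathbf{Alg}_K$ such that $\mathcal{F}(R)$ is an $R$-algebra for every $R\in\mathbf{alg}_K$. A $K$-algebra functor $\mathcal{F}$ is extension invariant if for every $R\in\mathbf{alg}_K$ there is an $R$-algebra isomorphism $\tau_R\colon\mathcal{F}(R)\to\mathcal{F}(K)\otimes_K R$ that is natural in $R$, i.e. for every homomorphism $\alpha\colon R\to R'$ in $\mathbf{alg}_K$ one has $(1_{\mathcal{F}(K)}\otimes_K\alpha)\circ\tau_R=\tau_{R'}\circ\mathcal{F}(\alpha)$. $|K|$ denotes the cardinality of $K$; dimensions are (possibly infinite) cardinals. *)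

theory Defs
  imports "HOL-Algebra.Algebra"
begin

unbundle cardinal_syntax

text \<open>
  Algebras that need not be associative, commutative or unital are represented by the
  \<open>module\<close> record of HOL-Algebra; its field \<open>one\<close> is ignored for them.
\<close>

locale nonassoc_algebra = module R A for R (structure) and A (structure) +
  assumes mult_closed:
      "x \<in> carrier A \<Longrightarrow> y \<in> carrier A \<Longrightarrow> x \<otimes>\<^bsub>A\<^esub> y \<in> carrier A"
    and mult_l_distr:
      "x \<in> carrier A \<Longrightarrow> y \<in> carrier A \<Longrightarrow> z \<in> carrier A \<Longrightarrow>
        (x \<oplus>\<^bsub>A\<^esub> y) \<otimes>\<^bsub>A\<^esub> z = x \<otimes>\<^bsub>A\<^esub> z \<oplus>\<^bsub>A\<^esub> y \<otimes>\<^bsub>A\<^esub> z"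
    and mult_r_distr:
      "x \<in> carrier A \<Longrightarrow> y \<in> carrier A \<Longrightarrow> z \<in> carrier A \<Longrightarrow>
        x \<otimes>\<^bsub>A\<^esub> (y \<oplus>\<^bsub>A\<^esub> z) = x \<otimes>\<^bsub>A\<^esub> y \<oplus>\<^bsub>A\<^esub> x \<otimes>\<^bsub>A\<^esub> z"
    and smult_mult_l:
      "r \<in> carrier R \<Longrightarrow> x \<in> carrier A \<Longrightarrow> y \<in> carrier A \<Longrightarrow>
        (r \<odot>\<^bsub>A\<^esub> x) \<otimes>\<^bsub>A\<^esub> y = r \<odot>\<^bsub>A\<^esub> (x \<otimes>\<^bsub>A\<^esub> y)"
    and smult_mult_r:
      "r \<in> carrier R \<Longrightarrow> x \<in> carrier A \<Longrightarrow> y \<in> carrier A \<Longrightarrow>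
        x \<otimes>\<^bsub>A\<^esub> (r \<odot>\<^bsub>A\<^esub> y) = r \<odot>\<^bsub>A\<^esub> (x \<otimes>\<^bsub>A\<^esub> y)"

text \<open>
  Morphisms are extensional functions, so that two morphisms are equal as soon as they
  agree on the carrier of their domain.
\<close>

definition nalg_hom ::
  "('k, 'm) ring_scheme \<Rightarrow> ('k, 'a, 'n) module_scheme \<Rightarrow> ('k, 'b, 'o) module_scheme \<Rightarrow> ('a \<Rightarrow> 'b) set"
  where "nalg_hom K A B =
    {f \<in> carrier A \<rightarrow>\<^sub>E carrier B.
      (\<forall>x\<in>carrier A. \<forall>y\<in>carrier A. f (x \<oplus>\<^bsub>A\<^esub> y) = f x \<oplus>\<^bsub>B\<^esub> f y) \<and>
      (\<forall>x\<in>carrier A. \<forall>y\<in>carrier A. f (x \<otimes>\<^bsub>A\<^esub> y) = f x \<otimes>\<^bsub>B\<^esub> f y) \<and>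
      (\<forall>k\<in>carrier K. \<forall>x\<in>carrier A. f (k \<odot>\<^bsub>A\<^esub> x) = k \<odot>\<^bsub>B\<^esub> f x)}"

definition nalg_iso ::
  "('k, 'm) ring_scheme \<Rightarrow> ('k, 'a, 'n) module_scheme \<Rightarrow> ('k, 'b, 'o) module_scheme \<Rightarrow> ('a \<Rightarrow> 'b) set"
  where "nalg_iso K A B = {f \<in> nalg_hom K A B. bij_betw f (carrier A) (carrier B)}"

definition nalg_isomorphic ::
  "('k, 'm) ring_scheme \<Rightarrow> ('k, 'a, 'n) module_scheme \<Rightarrow> ('k, 'b, 'o) module_scheme \<Rightarrow> bool"
  where "nalg_isomorphic K A B \<longleftrightarrow> nalg_iso K A B \<noteq> {}"

text \<open>
  The category of associative, commutative, unital, nonzero \<open>K\<close>-algebras. The carriers of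
  its objects are subsets of a type, which plays the role of the universe; scalars live in
  the same type so that \<open>K\<close> and its extension fields are themselves objects.
\<close>

definition calg :: "'u ring \<Rightarrow> ('u, 'u) module set"
  where "calg K = {R. algebra K R \<and> \<one>\<^bsub>R\<^esub> \<noteq> \<zero>\<^bsub>R\<^esub>}"

definition calg_hom :: "'u ring \<Rightarrow> ('u, 'u) module \<Rightarrow> ('u, 'u) module \<Rightarrow> ('u \<Rightarrow> 'u) set"
  where "calg_hom K R S =
    {\<alpha> \<in> ring_hom R S. \<alpha> \<in> extensional (carrier R) \<and>
      (\<forall>k\<in>carrier K. \<forall>x\<in>carrier R. \<alpha> (k \<odot>\<^bsub>R\<^esub> x) = k \<odot>\<^bsub>S\<^esub> \<alpha> x)}"

text \<open>
  A ring regarded as an algebra over itself, and equally over any of its subrings: only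
  the set of admissible scalars differs, and that set is not part of the record.
\<close>

definition self_algebra :: "'u ring \<Rightarrow> ('u, 'u) module"
  where "self_algebra S =
    \<lparr>carrier = carrier S, monoid.mult = monoid.mult S, one = \<one>\<^bsub>S\<^esub>,
     ring.zero = \<zero>\<^bsub>S\<^esub>, add = add S, smult = monoid.mult S\<rparr>"

text \<open>The \<open>K\<close>-algebra underlying an \<open>R\<close>-algebra \<open>A\<close>, for a unital \<open>K\<close>-algebra \<open>R\<close>.\<close>

definition restrict_scalars :: "('u, 'u) module \<Rightarrow> ('u, 'v) module \<Rightarrow> ('u, 'v) module"
  where "restrict_scalars R A = A\<lparr>smult := \<lambda>k a. (k \<odot>\<^bsub>R\<^esub> \<one>\<^bsub>R\<^esub>) \<odot>\<^bsub>A\<^esub> a\<rparr>"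

text \<open>
  A functor into all \<open>K\<close>-algebras whose value at \<open>R\<close> is an \<open>R\<close>-algebra: \<open>Fo R\<close> records the
  \<open>R\<close>-algebra structure, and the \<open>K\<close>-algebra structure of the value is the one obtained by
  restriction of scalars. The map \<open>Fm\<close> on morphisms also receives domain and codomain.
\<close>

locale algebra_functor =
  fixes K :: "'u ring"
    and Fo :: "('u, 'u) module \<Rightarrow> ('u, 'v) module"
    and Fm :: "('u, 'u) module \<Rightarrow> ('u, 'u) module \<Rightarrow> ('u \<Rightarrow> 'u) \<Rightarrow> ('v \<Rightarrow> 'v)"
  assumes Fo_algebra: "R \<in> calg K \<Longrightarrow> nonassoc_algebra R (Fo R)"
    and Fm_hom:
      "R \<in> calg K \<Longrightarrow> S \<in> calg K \<Longrightarrow> \<alpha> \<in> calg_hom K R S \<Longrightarrow>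
        Fm R S \<alpha> \<in> nalg_hom K (restrict_scalars R (Fo R)) (restrict_scalars S (Fo S))"
    and Fm_id:
      "R \<in> calg K \<Longrightarrow> Fm R R (restrict id (carrier R)) = restrict id (carrier (Fo R))"
    and Fm_comp:
      "R \<in> calg K \<Longrightarrow> S \<in> calg K \<Longrightarrow> T \<in> calg K \<Longrightarrow>
        \<alpha> \<in> calg_hom K R S \<Longrightarrow> \<beta> \<in> calg_hom K S T \<Longrightarrow>
        Fm R T (compose (carrier R) \<beta> \<alpha>) = compose (carrier (Fo R)) (Fm S T \<beta>) (Fm R S \<alpha>)"

text \<open>
  The tensor product \<open>A \<otimes>\<^sub>K R\<close> is the free abelian group on \<open>A \<times> R\<close> modulo the
  subgroup generated by the usual \<open>K\<close>-balanced bilinearity relations.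
\<close>

definition tensor_relations ::
  "'u ring \<Rightarrow> ('u, 'v) module \<Rightarrow> ('u, 'u) module \<Rightarrow> ('v \<times> 'u \<Rightarrow>\<^sub>0 int) set"
  where "tensor_relations K A R =
    {frag_of (a \<oplus>\<^bsub>A\<^esub> b, r) - frag_of (a, r) - frag_of (b, r) |a b r.
       a \<in> carrier A \<and> b \<in> carrier A \<and> r \<in> carrier R} \<union>
    {frag_of (a, r \<oplus>\<^bsub>R\<^esub> s) - frag_of (a, r) - frag_of (a, s) |a r s.
       a \<in> carrier A \<and> r \<in> carrier R \<and> s \<in> carrier R} \<union>
    {frag_of (k \<odot>\<^bsub>A\<^esub> a, r) - frag_of (a, k \<odot>\<^bsub>R\<^esub> r) |k a r.
       k \<in> carrier K \<and> a \<in> carrier A \<and> r \<in> carrier R}"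

definition tensor_free ::
  "('u, 'v) module \<Rightarrow> ('u, 'u) module \<Rightarrow> ('v \<times> 'u \<Rightarrow>\<^sub>0 int) monoid"
  where "tensor_free A R = free_Abelian_group (carrier A \<times> carrier R)"

definition tensor_kernel ::
  "'u ring \<Rightarrow> ('u, 'v) module \<Rightarrow> ('u, 'u) module \<Rightarrow> ('v \<times> 'u \<Rightarrow>\<^sub>0 int) set"
  where "tensor_kernel K A R = generate (tensor_free A R) (tensor_relations K A R)"

definition tensor_class ::
  "'u ring \<Rightarrow> ('u, 'v) module \<Rightarrow> ('u, 'u) module \<Rightarrow> ('v \<times> 'u \<Rightarrow>\<^sub>0 int) \<Rightarrow> ('v \<times> 'u \<Rightarrow>\<^sub>0 int) set"
  where "tensor_class K A R x = tensor_kernel K A R #>\<^bsub>tensor_free A R\<^esub> x"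

text \<open>
  As an \<open>R\<close>-algebra: \<open>(a \<otimes> r)(b \<otimes> s) = ab \<otimes> rs\<close> and \<open>s(a \<otimes> r) = a \<otimes> sr\<close>, extended
  additively to formal sums and then to classes (the unions are over representatives, as in
  the library's quotient rings).
\<close>

definition tensor_algebra ::
  "'u ring \<Rightarrow> ('u, 'v) module \<Rightarrow> ('u, 'u) module \<Rightarrow> ('u, ('v \<times> 'u \<Rightarrow>\<^sub>0 int) set) module"
  where "tensor_algebra K A R =
    \<lparr>carrier = carrier (tensor_free A R Mod tensor_kernel K A R),
     monoid.mult = (\<lambda>U V. \<Union>x\<in>U. \<Union>y\<in>V. tensor_class K A R
       (frag_extend (\<lambda>(a, r). frag_extend (\<lambda>(b, s). frag_of (a \<otimes>\<^bsub>A\<^esub> b, r \<otimes>\<^bsub>R\<^esub> s)) y) x)),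
     one = tensor_class K A R (frag_of (\<one>\<^bsub>A\<^esub>, \<one>\<^bsub>R\<^esub>)),
     ring.zero = \<one>\<^bsub>tensor_free A R Mod tensor_kernel K A R\<^esub>,
     add = monoid.mult (tensor_free A R Mod tensor_kernel K A R),
     smult = (\<lambda>s U. \<Union>x\<in>U. tensor_class K A R
       (frag_extend (\<lambda>(a, r). frag_of (a, s \<otimes>\<^bsub>R\<^esub> r)) x))\<rparr>"

text \<open>The map \<open>1\<^sub>A \<otimes>\<^sub>K \<alpha>\<close> from \<open>A \<otimes>\<^sub>K R\<close> to \<open>A \<otimes>\<^sub>K S\<close>, where \<open>\<alpha>\<close> maps \<open>R\<close> to \<open>S\<close>.\<close>

definition tensor_map ::
  "'u ring \<Rightarrow> ('u, 'v) module \<Rightarrow> ('u, 'u) module \<Rightarrow> ('u \<Rightarrow> 'u) \<Rightarrow>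
    ('v \<times> 'u \<Rightarrow>\<^sub>0 int) set \<Rightarrow> ('v \<times> 'u \<Rightarrow>\<^sub>0 int) set"
  where "tensor_map K A S \<alpha> U =
    (\<Union>x\<in>U. tensor_class K A S (frag_extend (\<lambda>(a, r). frag_of (a, \<alpha> r)) x))"

definition extension_invariant ::
  "'u ring \<Rightarrow> (('u, 'u) module \<Rightarrow> ('u, 'v) module) \<Rightarrow>
    (('u, 'u) module \<Rightarrow> ('u, 'u) module \<Rightarrow> ('u \<Rightarrow> 'u) \<Rightarrow> ('v \<Rightarrow> 'v)) \<Rightarrow> bool"
  where "extension_invariant K Fo Fm \<longleftrightarrow>
    (\<exists>\<tau>. (\<forall>R\<in>calg K. \<tau> R \<in> nalg_iso R (Fo R) (tensor_algebra K (Fo (self_algebra K)) R)) \<and>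
         (\<forall>R\<in>calg K. \<forall>S\<in>calg K. \<forall>\<alpha>\<in>calg_hom K R S. \<forall>x\<in>carrier (Fo R).
            tensor_map K (Fo (self_algebra K)) S \<alpha> (\<tau> R x) = \<tau> S (Fm R S \<alpha> x)))"

definition is_basis :: "('k, 'm) ring_scheme \<Rightarrow> ('k, 'a, 'n) module_scheme \<Rightarrow> 'a set \<Rightarrow> bool"
  where "is_basis K M B \<longleftrightarrow> B \<subseteq> carrier M \<and>
    (\<forall>S c. finite S \<longrightarrow> S \<subseteq> B \<longrightarrow> c \<in> S \<rightarrow> carrier K \<longrightarrow>
       (\<Oplus>\<^bsub>M\<^esub>b\<in>S. c b \<odot>\<^bsub>M\<^esub> b) = \<zero>\<^bsub>M\<^esub> \<longrightarrow> (\<forall>b\<in>S. c b = \<zero>\<^bsub>K\<^esub>)) \<and>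
    (\<forall>x\<in>carrier M. \<exists>S c. finite S \<and> S \<subseteq> B \<and> c \<in> S \<rightarrow> carrier K \<and>
       x = (\<Oplus>\<^bsub>M\<^esub>b\<in>S. c b \<odot>\<^bsub>M\<^esub> b))"

text \<open>
  The dimension, a possibly infinite cardinal. Over a field a basis exists and all bases
  have the same cardinality.
\<close>

definition vdim :: "('k, 'm) ring_scheme \<Rightarrow> ('k, 'a, 'n) module_scheme \<Rightarrow> 'a rel"
  where "vdim K M = |SOME B. is_basis K M B|"

end

theory Submission
  imports Defs
begin

text \<open>
  Write \<open>A\<close> and \<open>A'\<close> for the values at \<open>K\<close> of the two functors. Extension invariance says that
  their values at \<open>F\<close> are \<open>A \<otimes>\<^sub>K F\<close> and \<open>A' \<otimes>\<^sub>K F\<close>, so a \<open>K\<close>-isomorphism between \<open>A\<close> and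
  \<open>A'\<close> extends to \<open>F\<close> by the universal property of the tensor product.

  Conversely, let \<open>f\<close> be an \<open>F\<close>-isomorphism between the tensor products. Written on spanning
  sets of \<open>A\<close> and \<open>A'\<close>, the maps \<open>f\<close> and \<open>f\<inverse>\<close> involve a set \<open>G\<close> of scalars of \<open>F\<close> which is
  finite or of cardinality less than \<open>|K|\<close>, because each column has finitely many nonzero entries
  and the dimensions are less than \<open>|K|\<close>. Hence both maps are defined over the subring
  \<open>R = K[G]\<close> of \<open>F\<close>. A \<open>K\<close>-algebra homomorphism from \<open>R\<close> to \<open>K\<close> turns \<open>f\<close> and \<open>f\<inverse>\<close> into
  mutually inverse homomorphisms between \<open>A\<close> and \<open>A'\<close>, since all identities that express this
  are polynomial identities between elements of \<open>R\<close>.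

  Such a homomorphism exists because \<open>R\<close> modulo a maximal ideal is a field extension \<open>L\<close> of \<open>K\<close>
  which is generated as a ring by few elements, and this forces \<open>L\<close> to be algebraic over \<open>K\<close>,
  hence equal to \<open>K\<close>. For finitely many generators this is Zariski's lemma
  (\<open>zariski_lemma\<close>). For an infinite set of fewer than \<open>|K|\<close> generators it is a count of
  dimensions (\<open>algebraic_of_few_generators\<close>): \<open>L\<close> is spanned by the monomials in the generators, of
  which there are fewer than \<open>|K|\<close>, whereas a transcendental \<open>t\<close> would give the \<open>|K|\<close> linearly
  independent elements \<open>1/(t - a)\<close>. The outcome is the lemma \<open>exists_specialization\<close>.

  It is convenient to have the homomorphism defined as a \<open>K\<close>-linear functional \<open>\<phi>\<close> on all of \<open>F\<close>
  that is multiplicative only on \<open>R\<close>. Then \<open>a \<otimes> r \<mapsto> \<phi>(r) a\<close> is well defined on the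
  whole of \<open>A \<otimes>\<^sub>K F\<close> by the universal property, and the specialized isomorphism can be described
  without coordinates: it sends \<open>a\<close> to the image of \<open>f(a \<otimes> 1)\<close> under this map for \<open>A'\<close>
  (\<open>iso_descends\<close>).
\<close>

section \<open>Spans and bases\<close>

text \<open>
  Sums are closed under pairwise addition here instead of being indexed by finite sets, so that
  statements about a span are proved by induction. The set \<open>S\<close> of scalars is arbitrary because the
  finite sets of coefficients below are not subrings.
\<close>

inductive_set lin_span :: "'k set \<Rightarrow> ('k, 'a, 'n) module_scheme \<Rightarrow> 'a set \<Rightarrow> 'a set"
  for S M G where
    zero: "\<zero>\<^bsub>M\<^esub> \<in> lin_span S M G"
  | incl: "g \<in> G \<Longrightarrow> g \<in> lin_span S M G"
  | add: "x \<in> lin_span S M G \<Longrightarrow> y \<in> lin_span S M G \<Longrightarrow> x \<oplus>\<^bsub>M\<^esub> y \<in> lin_span S M G"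
  | smult: "s \<in> S \<Longrightarrow> x \<in> lin_span S M G \<Longrightarrow> s \<odot>\<^bsub>M\<^esub> x \<in> lin_span S M G"

lemma lin_span_mono:
  assumes "S \<subseteq> T"
  shows "lin_span S M G \<subseteq> lin_span T M G"
proof
  fix x assume "x \<in> lin_span S M G"
  then show "x \<in> lin_span T M G"
    using assms by induction (auto intro: lin_span.intros)
qed

text \<open>
  A single vector of a span involves only finitely many scalars; this is what bounds the number of
  coefficients of a linear map.
\<close>

lemma lin_span_finite_scalars:
  assumes "x \<in> lin_span S M G"
  shows "\<exists>U. finite U \<and> U \<subseteq> S \<and> x \<in> lin_span U M G"
  using assms
proof induction
  case zero
  then show ?case by (metis empty_subsetI finite.emptyI lin_span.zero)
next
  case (incl g)
  then show ?case by (metis empty_subsetI finite.emptyI lin_span.incl)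
next
  case (add x y)
  then obtain U V where "finite U" "U \<subseteq> S" "x \<in> lin_span U M G"
    "finite V" "V \<subseteq> S" "y \<in> lin_span V M G" by blast
  moreover have "x \<in> lin_span (U \<union> V) M G" "y \<in> lin_span (U \<union> V) M G"
    using calculation lin_span_mono[of U "U \<union> V" M G] lin_span_mono[of V "U \<union> V" M G] by auto
  ultimately show ?case
    by (intro exI[of _ "U \<union> V"]) (auto intro: lin_span.add)
next
  case (smult s x)
  then obtain U where "finite U" "U \<subseteq> S" "x \<in> lin_span U M G" by blast
  moreover have "x \<in> lin_span (insert s U) M G"
    using calculation lin_span_mono[of U "insert s U" M G] by auto
  ultimately show ?case
    using smult.hyps by (intro exI[of _ "insert s U"]) (auto intro: lin_span.smult)
qed

lemma (in module) lin_span_in_carrier: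
  assumes "S \<subseteq> carrier R" "G \<subseteq> carrier M"
  shows "lin_span S M G \<subseteq> carrier M"
proof
  fix x assume "x \<in> lin_span S M G"
  then show "x \<in> carrier M"
    using assms by induction auto
qed

lemma (in module) finsum_in_lin_span:
  assumes "finite S" "S \<subseteq> B" "B \<subseteq> carrier M" "c \<in> S \<rightarrow> carrier R"
  shows "(\<Oplus>\<^bsub>M\<^esub>b\<in>S. c b \<odot>\<^bsub>M\<^esub> b) \<in> lin_span (carrier R) M B"
  using assms
proof (induction S)
  case empty
  then show ?case by (simp add: lin_span.zero)
next
  case (insert b S)
  then have "(\<Oplus>\<^bsub>M\<^esub>b\<in>insert b S. c b \<odot>\<^bsub>M\<^esub> b) = c b \<odot>\<^bsub>M\<^esub> b \<oplus>\<^bsub>M\<^esub> (\<Oplus>\<^bsub>M\<^esub>b\<in>S. c b \<odot>\<^bsub>M\<^esub> b)"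
    by (intro M.finsum_insert) auto
  moreover have "(\<Oplus>\<^bsub>M\<^esub>b\<in>S. c b \<odot>\<^bsub>M\<^esub> b) \<in> lin_span (carrier R) M B" "c b \<in> carrier R" "b \<in> B"
    using insert by auto
  ultimately show ?case
    by (simp add: lin_span.add lin_span.smult lin_span.incl)
qed

lemma (in module) basis_spans:
  assumes "is_basis R M B"
  shows "lin_span (carrier R) M B = carrier M"
proof
  have B: "B \<subseteq> carrier M" using assms by (simp add: is_basis_def)
  show "lin_span (carrier R) M B \<subseteq> carrier M" using B by (intro lin_span_in_carrier) auto
  show "carrier M \<subseteq> lin_span (carrier R) M B"
  proof
    fix x assume "x \<in> carrier M"
    then have "\<exists>S c. finite S \<and> S \<subseteq> B \<and> c \<in> S \<rightarrow> carrier R \<and> x = (\<Oplus>\<^bsub>M\<^esub>b\<in>S. c b \<odot>\<^bsub>M\<^esub> b)"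
      using assms unfolding is_basis_def by simp
    then obtain S c where "finite S" "S \<subseteq> B" "c \<in> S \<rightarrow> carrier R"
      "x = (\<Oplus>\<^bsub>M\<^esub>b\<in>S. c b \<odot>\<^bsub>M\<^esub> b)" by (elim exE conjE)
    then show "x \<in> lin_span (carrier R) M B" using finsum_in_lin_span[of S B c] B by simp
  qed
qed

text \<open>
  A maximal linearly independent set spans: if \<open>x\<close> could be added to it only at the cost of a
  relation, then \<open>x\<close> occurs in this relation with a nonzero, hence invertible, coefficient.
\<close>

lemma (in module) vector_space_has_basis:
  assumes "field R"
  shows "\<exists>B. is_basis R M B"
proof -
  interpret Rf: field R by fact
  define indep where "indep B \<longleftrightarrow> B \<subseteq> carrier M \<and>
    (\<forall>S c. finite S \<longrightarrow> S \<subseteq> B \<longrightarrow> c \<in> S \<rightarrow> carrier R \<longrightarrow>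
       (\<Oplus>\<^bsub>M\<^esub>b\<in>S. c b \<odot>\<^bsub>M\<^esub> b) = \<zero>\<^bsub>M\<^esub> \<longrightarrow> (\<forall>b\<in>S. c b = \<zero>))" for B
  have "\<exists>B\<in>Collect indep. \<forall>C\<in>Collect indep. B \<subseteq> C \<longrightarrow> C = B"
  proof (rule subset_Zorn_nonempty)
    show "Collect indep \<noteq> {}" by (auto simp: indep_def intro!: exI[of _ "{}"])
    fix C assume C: "C \<noteq> {}" "subset.chain (Collect indep) C"
    have CI: "indep B" if "B \<in> C" for B using C that by (auto simp: subset_chain_def)
    have "\<forall>b\<in>S. c b = \<zero>"
      if S: "finite S" "S \<subseteq> \<Union>C" "c \<in> S \<rightarrow> carrier R" "(\<Oplus>\<^bsub>M\<^esub>b\<in>S. c b \<odot>\<^bsub>M\<^esub> b) = \<zero>\<^bsub>M\<^esub>" for S c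
    proof -
      obtain B where "B \<in> C" "S \<subseteq> B"
        using finite_subset_Union_chain[OF S(1,2) C] by blast
      then show ?thesis using CI S unfolding indep_def by blast
    qed
    moreover have "\<Union>C \<subseteq> carrier M" using CI by (auto simp: indep_def)
    ultimately show "\<Union>C \<in> Collect indep" by (simp add: indep_def)
  qed
  then obtain B where B: "indep B" and max: "\<And>C. indep C \<Longrightarrow> B \<subseteq> C \<Longrightarrow> C = B" by blast
  have BM: "B \<subseteq> carrier M" using B by (simp add: indep_def)
  have "\<exists>S c. finite S \<and> S \<subseteq> B \<and> c \<in> S \<rightarrow> carrier R \<and> x = (\<Oplus>\<^bsub>M\<^esub>b\<in>S. c b \<odot>\<^bsub>M\<^esub> b)"
    if x: "x \<in> carrier M" for x
  proof (cases "x \<in> B")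
    case True
    then show ?thesis
      using x by (intro exI[of _ "{x}"] exI[of _ "\<lambda>_. \<one>"]) auto
  next
    case False
    then have "\<not> indep (insert x B)" using max[of "insert x B"] by auto
    then obtain S c where S: "finite S" "S \<subseteq> insert x B" "c \<in> S \<rightarrow> carrier R"
      "(\<Oplus>\<^bsub>M\<^esub>b\<in>S. c b \<odot>\<^bsub>M\<^esub> b) = \<zero>\<^bsub>M\<^esub>" and nz: "\<exists>b\<in>S. c b \<noteq> \<zero>"
      using x BM unfolding indep_def by auto
    have "x \<in> S"
    proof (rule ccontr)
      assume "x \<notin> S"
      then have "S \<subseteq> B" using S by auto
      then show False using B S nz unfolding indep_def by blast
    qed
    define T where "T = S - {x}"
    have T: "finite T" "T \<subseteq> B" "c \<in> T \<rightarrow> carrier R" "x \<notin> T" "S = insert x T"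
      using S \<open>x \<in> S\<close> by (auto simp: T_def)
    have cx: "c x \<in> carrier R" using S \<open>x \<in> S\<close> by auto
    have cT: "(\<lambda>b. c b \<odot>\<^bsub>M\<^esub> b) \<in> T \<rightarrow> carrier M" using T BM by auto
    define y where "y = (\<Oplus>\<^bsub>M\<^esub>b\<in>T. c b \<odot>\<^bsub>M\<^esub> b)"
    have yM: "y \<in> carrier M" unfolding y_def using cT by (rule M.finsum_closed)
    have sum0: "c x \<odot>\<^bsub>M\<^esub> x \<oplus>\<^bsub>M\<^esub> y = \<zero>\<^bsub>M\<^esub>"
      using S(4) T cx x cT unfolding y_def T(5) by (subst (asm) M.finsum_insert) auto
    have cx0: "c x \<noteq> \<zero>"
    proof
      assume "c x = \<zero>"
      then have "y = \<zero>\<^bsub>M\<^esub>" using sum0 x yM by simp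
      then have "\<forall>b\<in>T. c b = \<zero>" using B T unfolding indep_def y_def by blast
      with \<open>c x = \<zero>\<close> nz T show False by auto
    qed
    define i where "i = inv (c x)"
    define d where "d = \<ominus> i"
    have inv: "i \<in> carrier R" "i \<otimes> c x = \<one>" and d: "d \<in> carrier R"
      using cx cx0 Rf.field_Units by (auto simp: i_def d_def)
    have "c x \<odot>\<^bsub>M\<^esub> x = \<ominus>\<^bsub>M\<^esub> y"
      using sum0 x cx yM M.minus_equality[of y] by (metis M.a_comm module.smult_closed module_axioms M.minus_equality)
    then have "x = i \<odot>\<^bsub>M\<^esub> (\<ominus>\<^bsub>M\<^esub> y)"
      using inv cx x smult_assoc1[of "i" "c x" x] by simp
    also have "\<dots> = d \<odot>\<^bsub>M\<^esub> y"
      using inv yM by (simp add: d_def smult_l_minus smult_r_minus)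
    also have "\<dots> = (\<Oplus>\<^bsub>M\<^esub>b\<in>T. d \<odot>\<^bsub>M\<^esub> (c b \<odot>\<^bsub>M\<^esub> b))"
      unfolding y_def using T cT d by (intro finsum_smult_ldistr) auto
    also have "\<dots> = (\<Oplus>\<^bsub>M\<^esub>b\<in>T. (d \<otimes> c b) \<odot>\<^bsub>M\<^esub> b)"
    proof (rule M.finsum_cong'[OF refl])
      show "(\<lambda>b. (d \<otimes> c b) \<odot>\<^bsub>M\<^esub> b) \<in> T \<rightarrow> carrier M" using T BM d by auto
      show "d \<odot>\<^bsub>M\<^esub> (c b \<odot>\<^bsub>M\<^esub> b) = (d \<otimes> c b) \<odot>\<^bsub>M\<^esub> b" if "b \<in> T" for b
        using T BM d that by (subst smult_assoc1) auto
    qed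
    finally show ?thesis
      using T d by (intro exI[of _ T] exI[of _ "\<lambda>b. d \<otimes> c b"]) auto
  qed
  then have "is_basis R M B" using B unfolding is_basis_def indep_def by blast
  then show ?thesis ..
qed

text \<open>
  As \<^const>\<open>vdim\<close> chooses some basis, it is the cardinality of an actual spanning set only because
  bases exist.
\<close>

corollary (in module) vdim_spanning_set:
  assumes "field R"
  obtains B where "B \<subseteq> carrier M" "lin_span (carrier R) M B = carrier M" "vdim R M = |B|"
proof -
  define B where "B = (SOME B. is_basis R M B)"
  have B: "is_basis R M B"
    unfolding B_def using vector_space_has_basis[OF assms] by (rule someI_ex)
  have "B \<subseteq> carrier M" using B unfolding is_basis_def by (rule conjunct1)
  then show ?thesis
    using basis_spans[OF B] by (rule that) (simp add: vdim_def B_def)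
qed

section \<open>Linear functionals on an extension field\<close>

text \<open>
  Let \<open>H\<close> be maximal among the subspaces that contain \<open>I\<close> but not \<open>1\<close>. Then every element
  is uniquely the sum of an element of \<open>H\<close> and an element of \<open>K\<close>, and the second summand is the value
  of the functional.
\<close>

lemma (in field) exists_linear_functional:
  assumes K: "subfield K R"
    and I: "I \<subseteq> carrier R" "\<zero> \<in> I" "\<And>x y. x \<in> I \<Longrightarrow> y \<in> I \<Longrightarrow> x \<oplus> y \<in> I"
      "\<And>k x. k \<in> K \<Longrightarrow> x \<in> I \<Longrightarrow> k \<otimes> x \<in> I" "\<one> \<notin> I"
  obtains \<phi> where "\<And>x. x \<in> carrier R \<Longrightarrow> \<phi> x \<in> K"
    "\<And>x y. x \<in> carrier R \<Longrightarrow> y \<in> carrier R \<Longrightarrow> \<phi> (x \<oplus> y) = \<phi> x \<oplus> \<phi> y"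
    "\<And>k x. k \<in> K \<Longrightarrow> x \<in> carrier R \<Longrightarrow> \<phi> (k \<otimes> x) = k \<otimes> \<phi> x"
    "\<phi> \<one> = \<one>" "\<And>x. x \<in> I \<Longrightarrow> \<phi> x = \<zero>"
proof -
  note KE = subringE[OF subfieldE(1)[OF K]]
  define sub where "sub H \<longleftrightarrow> I \<subseteq> H \<and> H \<subseteq> carrier R \<and> (\<forall>x\<in>H. \<forall>y\<in>H. x \<oplus> y \<in> H) \<and>
    (\<forall>k\<in>K. \<forall>x\<in>H. k \<otimes> x \<in> H) \<and> \<one> \<notin> H" for H
  have "\<exists>H\<in>Collect sub. \<forall>J\<in>Collect sub. H \<subseteq> J \<longrightarrow> J = H"
  proof (rule subset_Zorn_nonempty)
    show "Collect sub \<noteq> {}" using I by (auto simp: sub_def intro!: exI[of _ I])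
    fix C assume C: "C \<noteq> {}" "subset.chain (Collect sub) C"
    have CI: "sub H" if "H \<in> C" for H using C that by (auto simp: subset_chain_def)
    have "x \<oplus> y \<in> \<Union>C" if xy: "x \<in> \<Union>C" "y \<in> \<Union>C" for x y
    proof -
      obtain H where "H \<in> C" "{x, y} \<subseteq> H"
        using finite_subset_Union_chain[of "{x, y}" C] xy C by blast
      then have "x \<oplus> y \<in> H" using CI[of H] unfolding sub_def by simp
      then show ?thesis using \<open>H \<in> C\<close> by blast
    qed
    moreover have "I \<subseteq> \<Union>C" using C(1) CI unfolding sub_def by fast
    moreover have "\<Union>C \<subseteq> carrier R" "\<one> \<notin> \<Union>C" "\<forall>k\<in>K. \<forall>x\<in>\<Union>C. k \<otimes> x \<in> \<Union>C"
      using CI unfolding sub_def by blast+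
    ultimately show "\<Union>C \<in> Collect sub" by (simp add: sub_def)
  qed
  then obtain H where H: "sub H" and max: "\<And>J. sub J \<Longrightarrow> H \<subseteq> J \<Longrightarrow> J = H" by blast
  have HE: "I \<subseteq> H" "\<And>x. x \<in> H \<Longrightarrow> x \<in> carrier R" "\<And>x y. x \<in> H \<Longrightarrow> y \<in> H \<Longrightarrow> x \<oplus> y \<in> H"
    "\<And>k x. k \<in> K \<Longrightarrow> x \<in> H \<Longrightarrow> k \<otimes> x \<in> H" "\<one> \<notin> H"
    using H unfolding sub_def by blast+
  have Kc: "\<And>k. k \<in> K \<Longrightarrow> k \<in> carrier R" using KE(1) by blast
  have Hminus: "\<ominus> x \<in> H" if "x \<in> H" for x
    using HE(4)[of "\<ominus> \<one>" x] KE(3,5) that HE(2) by (simp add: l_minus)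
  have inH: "k = \<zero>" if "k \<in> K" "k \<in> H" for k
  proof (rule ccontr)
    assume "k \<noteq> \<zero>"
    then have "inv k \<in> K" "inv k \<otimes> k = \<one>" using subfield_m_inv[OF K, of k] that by auto
    then show False using HE(4)[of "inv k" k] HE(5) that by simp
  qed
  have dec: "\<exists>k\<in>K. x \<ominus> k \<in> H" if x: "x \<in> carrier R" for x
  proof (cases "x \<in> H")
    case True
    then show ?thesis using KE(2) x by (intro bexI[of _ \<zero>]) (auto simp: minus_eq)
  next
    case False
    define J where "J = {h \<oplus> k \<otimes> x | h k. h \<in> H \<and> k \<in> K}"
    have JI: "h \<oplus> k \<otimes> x \<in> J" if "h \<in> H" "k \<in> K" for h k
      unfolding J_def using that by blast
    have HJ: "H \<subseteq> J"
    proof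
      fix h assume "h \<in> H"
      then show "h \<in> J" using JI[of h \<zero>] KE(2) x HE(2) by simp
    qed
    have xJ: "x \<in> J"
      using JI[of \<zero> \<one>] I(2) HE(1) KE(3) x by auto
    have "\<not> sub J" using max[of J] HJ xJ False by auto
    moreover have "I \<subseteq> J" "J \<subseteq> carrier R" using HJ HE x Kc by (auto simp: J_def)
    moreover have "u \<oplus> v \<in> J" if uv: "u \<in> J" "v \<in> J" for u v
    proof -
      obtain h k h' k' where *: "u = h \<oplus> k \<otimes> x" "v = h' \<oplus> k' \<otimes> x" "h \<in> H" "h' \<in> H" "k \<in> K" "k' \<in> K"
        using uv by (auto simp: J_def)
      then have "u \<oplus> v = (h \<oplus> h') \<oplus> (k \<oplus> k') \<otimes> x"
        using x Kc HE(2) by (simp add: l_distr a_ac)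
      then show ?thesis using JI[of "h \<oplus> h'" "k \<oplus> k'"] *(3-6) HE(3) KE(7) by simp
    qed
    moreover have "l \<otimes> u \<in> J" if lu: "l \<in> K" "u \<in> J" for l u
    proof -
      obtain h k where *: "u = h \<oplus> k \<otimes> x" "h \<in> H" "k \<in> K"
        using lu by (auto simp: J_def)
      then have "l \<otimes> u = l \<otimes> h \<oplus> (l \<otimes> k) \<otimes> x"
        using x Kc HE(2) lu by (simp add: r_distr m_assoc)
      then show ?thesis using JI[of "l \<otimes> h" "l \<otimes> k"] *(2,3) HE(4) KE(6) lu(1) by simp
    qed
    ultimately have "\<one> \<in> J" unfolding sub_def by blast
    then obtain h k where hk: "\<one> = h \<oplus> k \<otimes> x" "h \<in> H" "k \<in> K" by (auto simp: J_def)
    have "k \<noteq> \<zero>" using hk HE(2,5) x by auto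
    then have inv: "inv k \<in> K" "inv k \<otimes> k = \<one>" using subfield_m_inv[OF K, of k] hk by auto
    have "inv k \<otimes> \<one> = inv k \<otimes> h \<oplus> (inv k \<otimes> k) \<otimes> x"
      using hk inv(1) x Kc HE(2) by (simp add: r_distr m_assoc)
    then have "inv k = inv k \<otimes> h \<oplus> x" using inv x Kc by simp
    moreover have "inv k \<otimes> h \<in> carrier R" "inv k \<in> carrier R" using inv hk Kc HE(2) by auto
    moreover have "x \<ominus> (y \<oplus> x) = \<ominus> y" if "y \<in> carrier R" for y
      using x that by algebra
    ultimately have "x \<ominus> inv k = \<ominus> (inv k \<otimes> h)" by metis
    then show ?thesis using inv hk HE(4) Hminus by (intro bexI[of _ "inv k"]) auto
  qed
  have uniq: "k = l" if "k \<in> K" "l \<in> K" "x \<in> carrier R" "x \<ominus> k \<in> H" "x \<ominus> l \<in> H" for x k l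
  proof -
    have "(x \<ominus> k) \<oplus> \<ominus> (x \<ominus> l) = l \<ominus> k"
      using that Kc by algebra
    then have "l \<ominus> k \<in> H" using HE(3) Hminus that by metis
    then have "l \<ominus> k = \<zero>" using inH that KE(5,7) by (simp add: minus_eq)
    then show ?thesis using that Kc by simp
  qed
  define \<phi> where "\<phi> x = (THE k. k \<in> K \<and> x \<ominus> k \<in> H)" for x
  have phi_eq: "\<phi> x = k" if "k \<in> K" "x \<in> carrier R" "x \<ominus> k \<in> H" for x k
    unfolding \<phi>_def using that uniq by blast
  have phi: "\<phi> x \<in> K" "x \<ominus> \<phi> x \<in> H" if "x \<in> carrier R" for x
    using dec[OF that] phi_eq that by auto
  show thesis
  proof
    show "\<phi> x \<in> K" if "x \<in> carrier R" for x using phi that by blast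
    show "\<phi> (x \<oplus> y) = \<phi> x \<oplus> \<phi> y" if xy: "x \<in> carrier R" "y \<in> carrier R" for x y
    proof (rule phi_eq)
      have "x \<oplus> y \<ominus> (\<phi> x \<oplus> \<phi> y) = (x \<ominus> \<phi> x) \<oplus> (y \<ominus> \<phi> y)"
        using xy Kc phi by algebra
      then show "x \<oplus> y \<ominus> (\<phi> x \<oplus> \<phi> y) \<in> H" using HE(3) phi xy by simp
    qed (use xy phi KE(7) in auto)
    show "\<phi> (k \<otimes> x) = k \<otimes> \<phi> x" if kx: "k \<in> K" "x \<in> carrier R" for k x
    proof (rule phi_eq)
      have "k \<otimes> x \<ominus> k \<otimes> \<phi> x = k \<otimes> (x \<ominus> \<phi> x)"
        using kx Kc phi by algebra
      then show "k \<otimes> x \<ominus> k \<otimes> \<phi> x \<in> H" using HE(4) phi kx by simp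
    qed (use kx phi Kc KE(6) in auto)
    show "\<phi> \<one> = \<one>"
      using KE(3) I(2) HE(1) by (intro phi_eq) (auto simp: minus_eq r_neg)
    show "\<phi> x = \<zero>" if "x \<in> I" for x
      using KE(2) HE(1,2) that by (intro phi_eq) (auto simp: minus_eq)
  qed
qed

section \<open>A ring as an algebra over its subrings\<close>

lemma cring_self_algebra:
  fixes R :: "'a ring" (structure)
  assumes "cring R"
  shows "cring (self_algebra R)"
proof -
  interpret cring R by fact
  have 1: "abelian_group (self_algebra R)"
    by (rule abelian_groupI) (auto simp: self_algebra_def a_assoc intro: a_comm add.l_inv_ex)
  have 2: "comm_monoid (self_algebra R)"
    by (rule comm_monoidI) (auto simp: self_algebra_def m_assoc intro: m_comm)
  show ?thesis by (rule cringI[OF 1 2]) (auto simp: self_algebra_def l_distr)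
qed

lemma algebra_self_algebra:
  fixes R :: "'a ring" (structure)
  assumes "cring R" "subring k R"
  shows "algebra (R\<lparr>carrier := k\<rparr>) (self_algebra R)"
proof -
  interpret cring R by fact
  have k: "x \<in> carrier R" if "x \<in> k" for x using subringE(1)[OF assms(2)] that by blast
  have "cring (R\<lparr>carrier := k\<rparr>)" using subcringI'[OF assms(2)] subcring_iff[OF subringE(1)[OF assms(2)]] by simp
  then show ?thesis
    using cring_self_algebra[OF assms(1)]
    by (rule algebraI) (auto simp: self_algebra_def k l_distr r_distr m_assoc)
qed

text \<open>
  The functors produce algebras over \<^term>\<open>self_algebra R\<close>, whose underlying ring is the one of
  \<open>R\<close>; the next lemmas replace the former by the latter.
\<close>

lemma nonassoc_algebra_self_algebra_scalars:
  fixes R :: "'u ring"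
  assumes "nonassoc_algebra (self_algebra R) A" and R: "cring R"
  shows "nonassoc_algebra R A"
proof -
  interpret A: nonassoc_algebra "self_algebra R" A by fact
  have [simp]: "carrier (self_algebra R) = carrier R" "add (self_algebra R) = add R"
    "monoid.mult (self_algebra R) = monoid.mult R" "\<one>\<^bsub>self_algebra R\<^esub> = \<one>\<^bsub>R\<^esub>"
    by (simp_all add: self_algebra_def)
  show ?thesis
  proof (rule nonassoc_algebra.intro)
    show "module R A"
      using A.smult_l_distr A.smult_r_distr A.smult_assoc1 A.smult_one A.smult_closed
      by (intro moduleI R A.abelian_group_axioms) simp_all
    show "nonassoc_algebra_axioms R A"
      using A.mult_closed A.mult_l_distr A.mult_r_distr A.smult_mult_l A.smult_mult_r
      by (intro nonassoc_algebra_axioms.intro) simp_all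
  qed
qed

lemma nalg_hom_self_algebra: "nalg_hom (self_algebra R) A B = nalg_hom R A B"
  by (simp add: nalg_hom_def self_algebra_def)

lemma nalg_iso_self_algebra: "nalg_iso (self_algebra R) A B = nalg_iso R A B"
  by (simp add: nalg_iso_def nalg_hom_self_algebra)

section \<open>Zariski's lemma\<close>

text \<open>
  \<open>P d t\<close> says that \<open>d\<close> clears the denominator of \<open>t\<close>, in one of several senses.
\<close>

lemma (in domain) common_denominator:
  assumes D: "subring D R" and "finite T"
    and "\<And>t. t \<in> T \<Longrightarrow> \<exists>d\<in>D - {\<zero>}. P d t"
    and mult: "\<And>d e t. t \<in> T \<Longrightarrow> P d t \<Longrightarrow> d \<in> D \<Longrightarrow> e \<in> D \<Longrightarrow> P (e \<otimes> d) t"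
  shows "\<exists>d\<in>D - {\<zero>}. \<forall>t\<in>T. P d t"
  using assms(2,3,4)
proof (induction T)
  case empty
  then show ?case using subringE(3)[OF D] one_not_zero by auto
next
  case (insert t T)
  note DE = subringE[OF D]
  obtain d where d: "d \<in> D - {\<zero>}" "\<forall>u\<in>T. P d u" using insert by blast
  obtain e where e: "e \<in> D - {\<zero>}" "P e t" using insert by blast
  have "e \<otimes> d \<noteq> \<zero>" using d(1) e(1) DE(1) integral by blast
  moreover have "e \<otimes> d = d \<otimes> e" using d(1) e(1) DE(1) m_comm by blast
  moreover have "e \<otimes> d \<in> D" using d e DE(6) by blast
  moreover have "P (e \<otimes> d) u" if "u \<in> T" for u using insert.prems(2)[of u d e] d e that by blast
  moreover have "P (d \<otimes> e) t" using insert.prems(2)[of t e d] d e by blast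
  ultimately show ?case by (intro bexI[of _ "e \<otimes> d"]) auto
qed

definition fractions :: "('a, 'b) ring_scheme \<Rightarrow> 'a set \<Rightarrow> 'a set"
  where "fractions R D = {y \<in> carrier R. \<exists>d\<in>D - {\<zero>\<^bsub>R\<^esub>}. d \<otimes>\<^bsub>R\<^esub> y \<in> D}"

lemma (in field) subset_fractions:
  assumes "subring D R"
  shows "D \<subseteq> fractions R D"
proof
  fix y assume "y \<in> D"
  then show "y \<in> fractions R D"
    unfolding fractions_def using subringE(1,3)[OF assms] by (auto intro!: bexI[of _ \<one>])
qed

lemma (in field) subfield_fractions:
  assumes D: "subring D R"
  shows "subfield (fractions R D) R"
proof (rule subfieldI')
  note DE = subringE[OF D]
  have Dc: "d \<in> carrier R" if "d \<in> D" for d using that DE(1) by blast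
  have I: "y \<in> fractions R D" if "y \<in> carrier R" "d \<in> D" "d \<noteq> \<zero>" "d \<otimes> y \<in> D" for y d
    using that by (auto simp: fractions_def)
  show "subring (fractions R D) R"
  proof (rule subringI)
    show "fractions R D \<subseteq> carrier R" by (auto simp: fractions_def)
    show "\<one> \<in> fractions R D" using subset_fractions[OF D] DE(3) by blast
    fix y assume "y \<in> fractions R D"
    then obtain d where y: "y \<in> carrier R" "d \<in> D" "d \<noteq> \<zero>" "d \<otimes> y \<in> D" by (auto simp: fractions_def)
    have "d \<otimes> (\<ominus> y) = \<ominus> (d \<otimes> y)" using y Dc by (simp add: r_minus)
    then show "\<ominus> y \<in> fractions R D" using I[of "\<ominus> y" d] y DE(5) by simp
    fix z assume "z \<in> fractions R D"
    then obtain e where z: "z \<in> carrier R" "e \<in> D" "e \<noteq> \<zero>" "e \<otimes> z \<in> D" by (auto simp: fractions_def)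
    have de: "d \<otimes> e \<in> D" "d \<otimes> e \<noteq> \<zero>" using y z DE(6) Dc integral[of d e] by auto
    have "(d \<otimes> e) \<otimes> (y \<otimes> z) = (d \<otimes> y) \<otimes> (e \<otimes> z)" using y z Dc by (simp add: m_ac)
    then show "y \<otimes> z \<in> fractions R D" using I[of "y \<otimes> z" "d \<otimes> e"] de y z DE(6) by simp
    have "(d \<otimes> e) \<otimes> (y \<oplus> z) = e \<otimes> (d \<otimes> y) \<oplus> d \<otimes> (e \<otimes> z)" using y z Dc by (simp add: m_ac r_distr)
    then show "y \<oplus> z \<in> fractions R D" using I[of "y \<oplus> z" "d \<otimes> e"] de y z DE(6,7) by simp
  qed
  fix y assume "y \<in> fractions R D - {\<zero>}"
  then obtain d where y: "y \<in> carrier R" "y \<noteq> \<zero>" "d \<in> D" "d \<noteq> \<zero>" "d \<otimes> y \<in> D"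
    by (auto simp: fractions_def)
  have inv: "inv y \<in> carrier R" "y \<otimes> inv y = \<one>" using y field_Units by auto
  have "(d \<otimes> y) \<otimes> inv y = d" using y inv Dc by (simp add: m_assoc)
  moreover have "d \<otimes> y \<noteq> \<zero>" using y Dc integral[of d y] by auto
  ultimately show "inv y \<in> fractions R D" using I[of "inv y" "d \<otimes> y"] y inv by simp
qed

text \<open>
  The core of Zariski's lemma, in the manner of Artin and Tate. Let the field be finite-dimensional
  over the fraction field \<open>E\<close> of \<open>D\<close> and generated as a ring by \<open>D\<close> and the finite set \<open>G\<close>. Then a
  single \<open>f\<close> clears, with its powers, the denominators of all fractions.

  Let \<open>N\<close> be the \<open>D\<close>-span of a finite spanning set \<open>Us\<close> over \<open>E\<close>. Choose \<open>f\<close> such that \<open>f\<close>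
  multiplies \<open>1\<close> and all products of an element of \<open>G\<close> with one of \<open>Us\<close> into \<open>N\<close>. The elements
  that some power of \<open>f\<close> multiplies into \<open>N\<close> are then closed under multiplication by \<open>D\<close> and \<open>G\<close>,
  so they are all elements of the field. To return from \<open>N\<close> to \<open>D\<close>, apply an \<open>E\<close>-linear functional
  with \<open>1 \<mapsto> 1\<close> whose values on \<open>Us\<close> have the denominator \<open>f\<close> too.
\<close>

lemma fractions_single_denominator:
  fixes R :: "'a ring" (structure)
  assumes "field R" and D: "subring D R"
    and Us: "set Us \<subseteq> carrier R" "ring.Span R (fractions R D) Us = carrier R"
    and G: "finite G" "G \<subseteq> carrier R" "generate_ring R (D \<union> G) = carrier R"
  shows "\<exists>f\<in>D - {\<zero>}. \<forall>y\<in>fractions R D. \<exists>n::nat. f [^] n \<otimes> y \<in> D"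
proof -
  interpret field R by fact
  interpret S: module R "self_algebra R"
    using algebra.module[OF algebra_self_algebra[OF is_cring carrier_is_subring]] by simp
  note DE = subringE[OF D]
  have Dc: "d \<in> carrier R" if "d \<in> D" for d using that DE(1) by blast
  define E where "E = fractions R D"
  have E: "subfield E R" unfolding E_def using D by (rule subfield_fractions)
  obtain \<phi> where \<phi>: "\<And>x. x \<in> carrier R \<Longrightarrow> \<phi> x \<in> E"
    "\<And>x y. x \<in> carrier R \<Longrightarrow> y \<in> carrier R \<Longrightarrow> \<phi> (x \<oplus> y) = \<phi> x \<oplus> \<phi> y"
    "\<And>k x. k \<in> E \<Longrightarrow> x \<in> carrier R \<Longrightarrow> \<phi> (k \<otimes> x) = k \<otimes> \<phi> x" "\<phi> \<one> = \<one>" "\<And>x. x \<in> {\<zero>} \<Longrightarrow> \<phi> x = \<zero>"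
  proof (rule exists_linear_functional[OF E, of "{\<zero>}"])
    show "k \<otimes> x \<in> {\<zero>}" if "k \<in> E" "x \<in> {\<zero>}" for k x using that subfieldE(3)[OF E] by auto
  qed auto
  define N where "N = lin_span D (self_algebra R) (set Us)"
  have N0: "\<zero> \<in> N" unfolding N_def using lin_span.zero[of "self_algebra R"] by (simp add: self_algebra_def)
  have Nadd: "x \<oplus> y \<in> N" if "x \<in> N" "y \<in> N" for x y
    using lin_span.add[of x D "self_algebra R" "set Us" y] that by (simp add: N_def self_algebra_def)
  have Nmult: "d \<otimes> x \<in> N" if "d \<in> D" "x \<in> N" for d x
    using lin_span.smult[of d D x "self_algebra R" "set Us"] that by (simp add: N_def self_algebra_def)
  have Nu: "u \<in> N" if "u \<in> set Us" for u
    using lin_span.incl[of u "set Us"] that by (simp add: N_def)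
  have Nc: "x \<in> carrier R" if "x \<in> N" for x
    using S.lin_span_in_carrier[of D "set Us"] DE(1) Us(1) that by (auto simp: N_def self_algebra_def)
  have N_induct[consumes 1, case_names zero gen add smult]: "P x" if "x \<in> N" "P \<zero>" "\<And>u. u \<in> set Us \<Longrightarrow> P u"
    "\<And>x y. x \<in> N \<Longrightarrow> y \<in> N \<Longrightarrow> P x \<Longrightarrow> P y \<Longrightarrow> P (x \<oplus> y)"
    "\<And>d x. d \<in> D \<Longrightarrow> x \<in> N \<Longrightarrow> P x \<Longrightarrow> P (d \<otimes> x)" for P x
    using that(1) unfolding N_def
  proof (induction rule: lin_span.induct)
    case zero show ?case using that(2) by (simp add: self_algebra_def)
  next
    case (incl g) then show ?case using that(3) by simp
  next
    case (add x y) then show ?case using that(4)[of x y] by (simp add: N_def self_algebra_def)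
  next
    case (smult s x) then show ?case using that(5)[of s x] by (simp add: N_def self_algebra_def)
  qed
  have denom: "\<exists>d\<in>D - {\<zero>}. d \<otimes> y \<in> N" if "y \<in> carrier R" for y
  proof -
    have "\<exists>d\<in>D - {\<zero>}. d \<otimes> y \<in> N" if "y \<in> Span E Vs" "set Vs \<subseteq> set Us" for y Vs
      using that
    proof (induction Vs arbitrary: y)
      case Nil
      then show ?case using DE(3) N0 by (intro bexI[of _ \<one>]) auto
    next
      case (Cons v Vs)
      then obtain k w where kw: "k \<in> E" "w \<in> Span E Vs" "y = k \<otimes> v \<oplus> w"
        by (auto simp: line_extension_mem_iff)
      have v: "v \<in> set Us" "v \<in> carrier R" using Cons.prems Us(1) by auto
      have w: "w \<in> carrier R"
        using kw(2) Span_in_carrier[of E Vs] Cons.prems Us(1) subfieldE(3)[OF E] by auto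
      obtain d where d: "d \<in> D" "d \<noteq> \<zero>" "d \<otimes> w \<in> N" using Cons kw by auto
      obtain e where e: "k \<in> carrier R" "e \<in> D" "e \<noteq> \<zero>" "e \<otimes> k \<in> D"
        using kw(1) by (auto simp: E_def fractions_def)
      have "(d \<otimes> e) \<otimes> y = d \<otimes> ((e \<otimes> k) \<otimes> v) \<oplus> e \<otimes> (d \<otimes> w)"
        using d e v w Dc kw(3) by (simp add: r_distr m_ac)
      also have "\<dots> \<in> N" using d e v Nadd Nmult Nu by simp
      finally show ?case using d e DE(6) Dc integral[of d e] by (intro bexI[of _ "d \<otimes> e"]) auto
    qed
    then show ?thesis using that Us(2) by (auto simp: E_def)
  qed
  have fin: "finite ((\<lambda>(x, u). x \<otimes> u) ` (G \<times> set Us))" using G(1) by simp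
  have "\<exists>d\<in>D - {\<zero>}. \<forall>t\<in>insert \<one> ((\<lambda>(x, u). x \<otimes> u) ` (G \<times> set Us)). t \<in> carrier R \<and> d \<otimes> t \<in> N"
  proof (rule common_denominator[OF D])
    show "\<exists>d\<in>D - {\<zero>}. t \<in> carrier R \<and> d \<otimes> t \<in> N" if "t \<in> insert \<one> ((\<lambda>(x, u). x \<otimes> u) ` (G \<times> set Us))" for t
    proof -
      have "t \<in> carrier R" using that G(2) Us(1) by auto
      then show ?thesis using denom by blast
    qed
    show "t \<in> carrier R \<and> e \<otimes> d \<otimes> t \<in> N" if "t \<in> carrier R \<and> d \<otimes> t \<in> N" "d \<in> D" "e \<in> D" for d e t
      using that Nmult[of e "d \<otimes> t"] Dc by (simp add: m_assoc)
  qed (use fin in simp)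
  then obtain d where d: "d \<in> D" "d \<noteq> \<zero>" "d \<in> N" "\<And>x u. x \<in> G \<Longrightarrow> u \<in> set Us \<Longrightarrow> d \<otimes> (x \<otimes> u) \<in> N"
    using Dc by force
  have "\<exists>e\<in>D - {\<zero>}. \<forall>u\<in>set Us. u \<in> carrier R \<and> e \<otimes> \<phi> u \<in> D"
  proof (rule common_denominator[OF D])
    show "\<exists>e\<in>D - {\<zero>}. u \<in> carrier R \<and> e \<otimes> \<phi> u \<in> D" if "u \<in> set Us" for u
      using that Us(1) \<phi>(1)[of u] by (auto simp: E_def fractions_def)
    show "t \<in> carrier R \<and> e \<otimes> d \<otimes> \<phi> t \<in> D" if "t \<in> carrier R \<and> d \<otimes> \<phi> t \<in> D" "d \<in> D" "e \<in> D" for d e t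
      using that DE(6)[of e "d \<otimes> \<phi> t"] Dc \<phi>(1)[of t] subfieldE(3)[OF E] by (auto simp: m_assoc)
  qed simp
  then obtain e where e: "e \<in> D" "e \<noteq> \<zero>" "\<And>u. u \<in> set Us \<Longrightarrow> e \<otimes> \<phi> u \<in> D" by blast
  define f where "f = d \<otimes> e"
  have f: "f \<in> D" "f \<noteq> \<zero>" "f \<in> carrier R" using d e DE(6) Dc integral[of d e] by (auto simp: f_def)
  have phiE: "\<phi> x \<in> carrier R" if "x \<in> carrier R" for x using \<phi>(1)[OF that] subfieldE(3)[OF E] by blast
  have phiN: "e \<otimes> \<phi> x \<in> D" if "x \<in> N" for x
    using that
  proof (induction rule: N_induct)
    case zero then show ?case using \<phi>(5) e DE(2) Dc by simp
  next
    case (gen u) then show ?case using e by simp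
  next
    case (add x y) then show ?case using \<phi>(2)[of x y] Nc DE(7) phiE e Dc by (simp add: r_distr)
  next
    case (smult s x)
    have "s \<in> E" using smult subset_fractions[OF D] by (auto simp: E_def)
    then have "e \<otimes> \<phi> (s \<otimes> x) = s \<otimes> (e \<otimes> \<phi> x)" using \<phi>(3)[of s x] smult Nc Dc e phiE by (simp add: m_ac)
    then show ?case using smult DE(6) by simp
  qed
  have fX: "f \<otimes> (x \<otimes> y) \<in> N" if "y \<in> N" "x \<in> G" for x y
    using that(1)
  proof (induction rule: N_induct)
    case zero then show ?case using f G(2) that(2) N0 by (auto simp: subset_iff)
  next
    case (gen u)
    have "f \<otimes> (x \<otimes> u) = e \<otimes> (d \<otimes> (x \<otimes> u))"
      using gen that(2) G(2) Us(1) d e Dc by (auto simp: f_def m_ac subset_iff)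
    then show ?case using d(4)[OF that(2) gen] Nmult e by simp
  next
    case (add u v)
    have "f \<otimes> (x \<otimes> (u \<oplus> v)) = f \<otimes> (x \<otimes> u) \<oplus> f \<otimes> (x \<otimes> v)"
      using add Nc that(2) G(2) f by (auto simp: r_distr subset_iff)
    then show ?case using add Nadd by simp
  next
    case (smult s u)
    have "f \<otimes> (x \<otimes> (s \<otimes> u)) = s \<otimes> (f \<otimes> (x \<otimes> u))"
      using smult Nc that(2) G(2) f Dc by (auto simp: m_ac subset_iff)
    then show ?case using smult Nmult by simp
  qed
  define M where "M = {y \<in> carrier R. \<exists>n::nat. f [^] n \<otimes> y \<in> N}"
  have fD: "f [^] n \<in> D" for n :: nat
    by (induction n) (use f DE(3,6) in auto)
  have Mup: "f [^] (n + m) \<otimes> y \<in> N" if "y \<in> carrier R" "f [^] n \<otimes> y \<in> N" for y and n m :: nat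
  proof -
    have "f [^] (n + m) \<otimes> y = f [^] m \<otimes> (f [^] n \<otimes> y)"
      using that f by (simp add: nat_pow_mult[symmetric] m_ac)
    then show ?thesis using Nmult fD that by simp
  qed
  have Madd: "y \<oplus> z \<in> M" if yz: "y \<in> M" "z \<in> M" for y z
  proof -
    obtain n m :: nat where nm: "f [^] n \<otimes> y \<in> N" "f [^] m \<otimes> z \<in> N" "y \<in> carrier R" "z \<in> carrier R"
      using yz by (auto simp: M_def)
    have "f [^] (n + m) \<otimes> (y \<oplus> z) = f [^] (n + m) \<otimes> y \<oplus> f [^] (m + n) \<otimes> z"
      using nm f by (simp add: r_distr add.commute)
    also have "\<dots> \<in> N" using Nadd Mup nm by simp
    finally show ?thesis using nm by (auto simp: M_def)
  qed
  have MD: "s \<otimes> y \<in> M" if sy: "s \<in> D" "y \<in> M" for s y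
  proof -
    obtain n :: nat where n: "f [^] n \<otimes> y \<in> N" "y \<in> carrier R" using sy by (auto simp: M_def)
    have "f [^] n \<otimes> (s \<otimes> y) = s \<otimes> (f [^] n \<otimes> y)" using n that Dc f by (simp add: m_ac)
    then show ?thesis using n Nmult that Dc by (auto simp: M_def intro!: exI[of _ n])
  qed
  have MX: "x \<otimes> y \<in> M" if xy: "x \<in> G" "y \<in> M" for x y
  proof -
    obtain n :: nat where n: "f [^] n \<otimes> y \<in> N" "y \<in> carrier R" using xy by (auto simp: M_def)
    have x: "x \<in> carrier R" using that G(2) by auto
    have "f [^] Suc n \<otimes> (x \<otimes> y) = f \<otimes> (x \<otimes> (f [^] n \<otimes> y))" using n x f by (simp add: m_ac)
    also have "\<dots> \<in> N" using fX n that by simp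
    finally show ?thesis using n x unfolding M_def by blast
  qed
  \<comment> \<open>The multipliers of \<open>M\<close> form a subring that contains the generators, and \<open>1\<close> lies in \<open>M\<close>, so \<open>M\<close> is everything.\<close>
  define Q where "Q = {y \<in> carrier R. \<forall>z\<in>M. y \<otimes> z \<in> M}"
  have Mc: "z \<in> carrier R" if "z \<in> M" for z using that by (simp add: M_def)
  have Mminus: "\<ominus> z \<in> M" if "z \<in> M" for z
    using MD[of "\<ominus> \<one>" z] DE(3,5) that Mc by (simp add: l_minus)
  have "subring Q R"
  proof (rule subringI)
    show "Q \<subseteq> carrier R" "\<one> \<in> Q" using Mc by (auto simp: Q_def)
    show "\<ominus> h \<in> Q" if "h \<in> Q" for h using that Mc Mminus by (auto simp: Q_def l_minus)
    show "h1 \<otimes> h2 \<in> Q" if "h1 \<in> Q" "h2 \<in> Q" for h1 h2 using that Mc by (auto simp: Q_def m_assoc)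
    show "h1 \<oplus> h2 \<in> Q" if "h1 \<in> Q" "h2 \<in> Q" for h1 h2 using that Mc Madd by (auto simp: Q_def l_distr)
  qed
  moreover have "D \<union> G \<subseteq> Q" using MD MX Dc G(2) by (auto simp: Q_def)
  moreover have "D \<union> G \<subseteq> carrier R" using DE(1) G(2) by simp
  ultimately have "carrier R \<subseteq> Q" using generate_ring_min_subring1 G(3) by metis
  moreover have "\<one> \<in> M"
  proof -
    have "f [^] (1::nat) \<otimes> \<one> = e \<otimes> d" using f d e Dc by (simp add: f_def m_comm)
    then show ?thesis using Nmult[of e d] d e by (auto simp: M_def intro!: exI[of _ "1::nat"])
  qed
  ultimately have allM: "y \<in> M" if "y \<in> carrier R" for y using that by (force simp: Q_def)
  have "\<exists>n::nat. f [^] n \<otimes> y \<in> D" if "y \<in> E" for y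
  proof -
    have y: "y \<in> carrier R" using that subfieldE(3)[OF E] by blast
    then obtain n :: nat where n: "f [^] n \<otimes> y \<in> N" using allM by (auto simp: M_def)
    have "f [^] n \<otimes> y \<in> E"
      using that fD subset_fractions[OF D] subringE(6)[OF subfieldE(1)[OF E]] by (auto simp: E_def)
    \<comment> \<open>On \<open>E\<close> the functional is the identity.\<close>
    then have "\<phi> (f [^] n \<otimes> y) = f [^] n \<otimes> y" using \<phi>(3)[of "f [^] n \<otimes> y" \<one>] \<phi>(4) y f by simp
    then have "d \<otimes> (e \<otimes> (f [^] n \<otimes> y)) \<in> D" using phiN[OF n] d DE(6) by simp
    moreover have "d \<otimes> (e \<otimes> (f [^] n \<otimes> y)) = f [^] Suc n \<otimes> y" using d e Dc f y by (simp add: f_def m_ac)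
    ultimately show ?thesis by metis
  qed
  then show ?thesis using f by (auto simp: E_def)
qed

text \<open>
  For transcendental \<open>x\<close> the ring \<open>E[x]\<close> is a polynomial ring, whose units are constants.
\<close>

lemma (in field) transcendental_unit_in_base:
  assumes E: "subfield E R" and x: "x \<in> carrier R" and tr: "(transcendental over E) x"
    and d: "d \<in> simple_extension E x" and i: "i \<in> simple_extension E x" and di: "d \<otimes> i = \<one>"
  shows "d \<in> E"
proof -
  note Er = subfieldE(1)[OF E]
  have Dimg: "simple_extension E x = (\<lambda>p. eval p x) ` carrier (E[X])"
    by (rule simple_extension_as_eval_img[OF subfieldE(3)[OF E] x])
  obtain p where p: "p \<in> carrier (E[X])" "eval p x = d" using d Dimg by auto
  obtain q where q: "q \<in> carrier (E[X])" "eval q x = i" using i Dimg by auto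
  interpret P: domain "E[X]" by (rule univ_poly_is_domain[OF Er])
  note hom = eval_is_hom[OF Er x]
  have "eval (p \<otimes>\<^bsub>E[X]\<^esub> q) x = eval \<one>\<^bsub>E[X]\<^esub> x"
    using ring_hom_mult[OF hom p(1) q(1)] ring_hom_one[OF hom] p q di by simp
  then have "p \<otimes>\<^bsub>E[X]\<^esub> q = \<one>\<^bsub>E[X]\<^esub>"
    using tr p(1) q(1) unfolding over_def transcendental_def inj_on_def by simp
  then have "p \<in> Units (E[X])" using p(1) q(1) P.m_comm[OF p(1) q(1)] unfolding Units_def by fastforce
  then obtain k where "k \<in> E" "p = [k]" using univ_poly_units_incl[OF Er] by auto
  then show "d \<in> E" using p(2) subfieldE(3)[OF E] by auto
qed

text \<open>
  As in Euclid's proof that there are infinitely many primes, \<open>1 + x f\<close> is coprime to \<open>f\<close>. If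
  it divides a power of \<open>f\<close> in \<open>E[x]\<close>, it is therefore a unit, which is impossible for
  transcendental \<open>x\<close>.
\<close>

lemma (in field) algebraic_of_single_denominator:
  assumes E: "subfield E R" and x: "x \<in> carrier R"
    and f: "f \<in> simple_extension E x - {\<zero>}"
      "\<And>d. d \<in> simple_extension E x - {\<zero>} \<Longrightarrow> \<exists>n::nat. f [^] n \<otimes> inv d \<in> simple_extension E x"
  shows "(algebraic over E) x"
proof (rule ccontr)
  assume "\<not> (algebraic over E) x"
  then have tr: "(transcendental over E) x" by (simp add: over_def)
  define D where "D = simple_extension E x"
  note Er = subfieldE(1)[OF E]
  have D: "subring D R" unfolding D_def using Er x by (rule simple_extension_is_subring)
  note DE = subringE[OF D]
  have Dc: "d \<in> carrier R" if "d \<in> D" for d using that DE(1) by blast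
  have ED: "E \<subseteq> D" unfolding D_def using simple_extension_incl[OF subfieldE(3)[OF E] x] .
  have xD: "x \<in> D" unfolding D_def using simple_extension_mem[OF Er x] .
  have Dimg: "D = (\<lambda>p. eval p x) ` carrier (E[X])"
    unfolding D_def by (rule simple_extension_as_eval_img[OF subfieldE(3)[OF E] x])
  have fD: "f \<in> D" "f \<noteq> \<zero>" "f \<in> carrier R" using f Dc by (auto simp: D_def)
  \<comment> \<open>Otherwise \<open>x f\<close> minus a constant would be a nonzero polynomial that vanishes at \<open>x\<close>.\<close>
  have not_E: "x \<otimes> f \<notin> E"
  proof
    assume e: "x \<otimes> f \<in> E"
    obtain p where p: "p \<in> carrier (E[X])" "f = eval p x" using fD Dimg by auto
    have "p \<noteq> []" using p fD by auto
    have pE: "set p \<subseteq> E" "lead_coeff p \<noteq> \<zero>"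
      using p(1) \<open>p \<noteq> []\<close> by (auto simp: univ_poly_def polynomial_def)
    define q where "q = p @ [\<ominus> (x \<otimes> f)]"
    have "set q \<subseteq> E" using pE e subringE(5)[OF Er] by (auto simp: q_def)
    then have "q \<in> carrier (E[X])" using pE \<open>p \<noteq> []\<close> by (auto simp: univ_poly_def polynomial_def q_def)
    moreover have "eval q x = \<zero>"
      using eval_append_aux[of p "\<ominus> (x \<otimes> f)" x] pE subfieldE(3)[OF E] x fD p(2) m_comm[OF x fD(3)]
      by (auto simp: q_def r_neg)
    moreover have "q \<noteq> []" by (simp add: q_def)
    ultimately have "(algebraic over E) x" by (intro algebraicI)
    then show False using tr by (simp add: over_def)
  qed
  define d where "d = \<one> \<oplus> x \<otimes> f"
  have dD: "d \<in> D" using DE(3,6,7) xD fD by (simp add: d_def)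
  have "d \<noteq> \<zero>"
  proof
    assume "d = \<zero>"
    then have "x \<otimes> f = \<ominus> \<one>" using x fD by (simp add: d_def) (metis add.inv_equality a_comm m_closed minus_equality one_closed)
    then show False using not_E subringE(3,5)[OF Er] by simp
  qed
  then have invd: "inv d \<in> carrier R" "d \<otimes> inv d = \<one>" using dD Dc field_Units by auto
  obtain n :: nat where n: "f [^] n \<otimes> inv d \<in> D" using f(2)[of d] dD \<open>d \<noteq> \<zero>\<close> by (auto simp: D_def)
  have fpow: "f [^] k \<in> D" for k :: nat by (induction k) (use fD DE(3,6) in auto)
  have xpow: "x [^] k \<in> D" for k :: nat by (induction k) (use xD DE(3,6) in auto)
  \<comment> \<open>Since \<open>1/d = 1 - x f/d\<close>, powers of \<open>f\<close> can be removed one at a time.\<close>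
  have step: "f [^] k \<otimes> inv d \<in> D" if "f [^] Suc k \<otimes> inv d \<in> D" for k :: nat
  proof -
    have "i = (\<one> \<oplus> x \<otimes> f) \<otimes> i \<ominus> x \<otimes> (f \<otimes> i)" if "i \<in> carrier R" for i
      using fD x that by algebra
    then have "f [^] k \<otimes> inv d = f [^] k \<otimes> (d \<otimes> inv d \<ominus> x \<otimes> (f \<otimes> inv d))"
      using invd unfolding d_def by metis
    also have "\<dots> = f [^] k \<ominus> x \<otimes> (f [^] Suc k \<otimes> inv d)"
      using fD x invd Dc fpow by simp algebra
    also have "\<dots> \<in> D" using that fpow DE(5,6,7) xD by (simp add: minus_eq)
    finally show ?thesis .
  qed
  have "f [^] (0::nat) \<otimes> inv d \<in> D"
    using n by (induction n) (use step in blast)+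
  then have "inv d \<in> D" using invd by simp
  then have "d \<in> E" using transcendental_unit_in_base[OF E x tr] dD invd by (simp add: D_def)
  moreover have "x \<otimes> f = d \<oplus> \<ominus> \<one>" using x fD by (simp add: d_def) algebra
  ultimately have "x \<otimes> f \<in> E" using subringE(3,5,7)[OF Er] by simp
  then show False using not_E by simp
qed

text \<open>
  Induction on the number of generators, for all base fields at once. By the induction hypothesis the
  field is finite-dimensional over the fraction field of \<open>E[x]\<close>, so
  \<open>fractions_single_denominator\<close> and \<open>algebraic_of_single_denominator\<close> show that \<open>x\<close> is algebraic. Then \<open>E[x]\<close> is itself a field, of finite dimension over \<open>E\<close>.
\<close>

theorem zariski_lemma:
  fixes R :: "'a ring" (structure)
  assumes "field R" "subfield E R" "set xs \<subseteq> carrier R"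
    and "generate_ring R (E \<union> set xs) = carrier R"
  shows "ring.finite_dimension R E (carrier R)"
  using assms(2-)
proof (induction xs arbitrary: E)
  case Nil
  interpret field R by fact
  have "carrier R \<subseteq> E"
    using generate_ring_min_subring1[of E E] subfieldE(1,3)[OF Nil(1)] Nil(3) by simp
  then have "E = carrier R" using subfieldE(3)[OF Nil(1)] by simp
  then show ?case using dimension_one[OF Nil(1)] finite_dimensionI by metis
next
  case (Cons x xs)
  interpret field R by fact
  define D where "D = simple_extension E x"
  define E' where "E' = fractions R D"
  note Er = subfieldE(1)[OF Cons.prems(1)]
  have x: "x \<in> carrier R" and xs: "set xs \<subseteq> carrier R" using Cons.prems by auto
  have D: "subring D R" unfolding D_def using Er x by (rule simple_extension_is_subring)
  have E'D: "D \<subseteq> E'" unfolding E'_def by (rule subset_fractions[OF D])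
  have ED: "E \<subseteq> D" "x \<in> D"
    unfolding D_def using simple_extension_incl[OF subringE(1)[OF Er] x] simple_extension_mem[OF Er x] by auto
  have E': "subfield E' R" unfolding E'_def by (rule subfield_fractions[OF D])
  have gen: "generate_ring R (S \<union> set xs) = carrier R" if "D \<subseteq> S" "S \<subseteq> carrier R" for S
  proof
    show "generate_ring R (S \<union> set xs) \<subseteq> carrier R" using that xs by (intro generate_ring_incl) auto
    have "E \<union> set (x # xs) \<subseteq> S \<union> set xs" using that ED by auto
    then show "carrier R \<subseteq> generate_ring R (S \<union> set xs)"
      using mono_generate_ring[of "E \<union> set (x # xs)" "S \<union> set xs"] that xs Cons.prems(3) by auto
  qed
  have fin: "finite_dimension E' (carrier R)"
    using Cons.IH[OF E' xs gen] E'D subfieldE(3)[OF E'] by simp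
  obtain Us where Us: "set Us \<subseteq> carrier R" "Span E' Us = carrier R"
    using fin exists_base[OF E'] by (metis finite_dimension_def)
  obtain f where f: "f \<in> D - {\<zero>}" "\<And>y. y \<in> E' \<Longrightarrow> \<exists>n::nat. f [^] n \<otimes> y \<in> D"
    using fractions_single_denominator[OF assms(1) D Us(1) _ _ xs gen] Us(2) subringE(1)[OF D]
    unfolding E'_def by auto
  have "(algebraic over E) x"
  proof (rule algebraic_of_single_denominator[OF Cons.prems(1) x])
    show "f \<in> simple_extension E x - {\<zero>}" using f by (simp add: D_def)
    fix d assume "d \<in> simple_extension E x - {\<zero>}"
    then have "d \<in> E' - {\<zero>}" using E'D by (auto simp: D_def)
    then have "inv d \<in> E'" using subfield_m_inv[OF E'] by blast
    then show "\<exists>n::nat. f [^] n \<otimes> inv d \<in> simple_extension E x" using f(2) by (simp add: D_def)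
  qed
  then have D_field: "subfield D R" and D_fin: "finite_dimension E D"
    using simple_extension_is_subfield[OF Cons.prems(1) x] finite_dimension_simple_extension[OF Cons.prems(1) x]
    by (auto simp: D_def)
  have "E' \<subseteq> D"
  proof
    fix y assume "y \<in> E'"
    then obtain d where d: "y \<in> carrier R" "d \<in> D - {\<zero>}" "d \<otimes> y \<in> D" by (auto simp: E'_def fractions_def)
    then show "y \<in> D" using subfield_m_inv_simprule[OF D_field] by blast
  qed
  then have "E' = D" using E'D by simp
  then show ?case
    using telescopic_base[OF Cons.prems(1) D_field] D_fin fin unfolding finite_dimension_def by blast
qed

section \<open>Fields with few generators\<close>

text \<open>
  This is the linear independence of the elements \<open>1/(t - a)\<close> for transcendental \<open>t\<close>. A
  relation for \<open>1/(t - b)\<close> is cleared by the product \<open>P\<close> of all \<open>t - a\<close>, so that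
  \<open>P/(t - b)\<close> lies in \<open>E[t]\<close>. As \<open>t - a\<close> is congruent modulo \<open>t - b\<close> to the nonzero constant
  \<open>b - a\<close>, the factors of \<open>P\<close> can be removed one at a time, which makes \<open>t - b\<close> a unit of
  \<open>E[t]\<close>.
\<close>

lemma (in field) inverse_linear_notin_Span:
  assumes E: "subfield E R" and t: "t \<in> carrier R" and tr: "(transcendental over E) t"
    and as: "set as \<subseteq> E" and b: "b \<in> E" "b \<notin> set as"
  shows "inv (t \<ominus> b) \<notin> Span E (map (\<lambda>a. inv (t \<ominus> a)) as)"
proof
  assume sp: "inv (t \<ominus> b) \<in> Span E (map (\<lambda>a. inv (t \<ominus> a)) as)"
  define D where "D = simple_extension E t"
  note Er = subfieldE(1)[OF E]
  have D: "subring D R" unfolding D_def using Er t by (rule simple_extension_is_subring)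
  note DE = subringE[OF D]
  have Dc: "d \<in> carrier R" if "d \<in> D" for d using that DE(1) by blast
  have ED: "E \<subseteq> D" unfolding D_def using simple_extension_incl[OF subfieldE(3)[OF E] t] .
  have Ec: "a \<in> carrier R" if "a \<in> E" for a using that subfieldE(3)[OF E] by blast
  have tD: "t \<in> D" unfolding D_def using simple_extension_mem[OF Er t] .
  have tE: "t \<notin> E" using algebraic_self[OF Er] tr by (auto simp: over_def)
  have ne: "t \<ominus> a \<noteq> \<zero>" if "a \<in> E" for a using that tE t Ec by auto
  have invs: "inv (t \<ominus> a) \<in> carrier R" "(t \<ominus> a) \<otimes> inv (t \<ominus> a) = \<one>" if "a \<in> E" for a
    using ne[OF that] field_Units t Ec[OF that] by auto
  have taD: "t \<ominus> a \<in> D" if "a \<in> E" for a using tD ED that DE(5,7) by (auto simp: minus_eq)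
  define P where "P = (\<lambda>as. foldr (\<lambda>a y. (t \<ominus> a) \<otimes> y) as \<one>)"
  have PD: "P as \<in> D" if "set as \<subseteq> E" for as
    using that by (induction as) (auto simp: P_def DE(3,6) taD)
  have clear: "P as \<otimes> v \<in> D" if "v \<in> Span E (map (\<lambda>a. inv (t \<ominus> a)) as)" "set as \<subseteq> E" for as v
    using that
  proof (induction as arbitrary: v)
    case Nil then show ?case by (simp add: P_def DE(2))
  next
    case (Cons a as)
    then obtain k w where kw: "k \<in> E" "w \<in> Span E (map (\<lambda>a. inv (t \<ominus> a)) as)" "v = k \<otimes> inv (t \<ominus> a) \<oplus> w"
      by (auto simp: line_extension_mem_iff)
    have a: "a \<in> E" "set as \<subseteq> E" using Cons.prems by auto
    have w: "w \<in> carrier R"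
      using kw(2) Span_in_carrier[OF subfieldE(3)[OF E], of "map (\<lambda>a. inv (t \<ominus> a)) as"] invs a by auto
    have u: "u \<otimes> p \<otimes> (k \<otimes> j \<oplus> w) = (u \<otimes> j) \<otimes> (k \<otimes> p) \<oplus> u \<otimes> (p \<otimes> w)"
      if "u \<in> carrier R" "p \<in> carrier R" "k \<in> carrier R" "j \<in> carrier R" for u p k j
      using that w by algebra
    have "P (a # as) \<otimes> v = k \<otimes> P as \<oplus> (t \<ominus> a) \<otimes> (P as \<otimes> w)"
      using u[of "t \<ominus> a" "P as" k "inv (t \<ominus> a)"] kw invs[OF a(1)] Ec a t PD[OF a(2)] Dc
      by (simp add: P_def)
    also have "\<dots> \<in> D"
      using Cons.IH[OF kw(2) a(2)] PD[OF a(2)] taD[OF a(1)] subsetD[OF ED kw(1)]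
      by (simp add: DE(6,7))
    finally show ?case .
  qed
  have "P as \<otimes> inv (t \<ominus> b) \<in> D" using clear[OF sp as] .
  then have "inv (t \<ominus> b) \<in> D"
    using as b(2)
  proof (induction as)
    case Nil
    then show ?case using invs(1)[OF b(1)] by (simp add: P_def)
  next
    case (Cons a as)
    have a: "a \<in> E" "set as \<subseteq> E" "b \<noteq> a" using Cons.prems by auto
    have i: "inv (t \<ominus> b) \<in> carrier R" "(t \<ominus> b) \<otimes> inv (t \<ominus> b) = \<one>" using invs[OF b(1)] by auto
    have p: "P as \<in> D" "P as \<in> carrier R" using PD a Dc by auto
    have u: "(b \<ominus> a) \<otimes> (p \<otimes> j) = (t \<ominus> a) \<otimes> p \<otimes> j \<ominus> p \<otimes> ((t \<ominus> b) \<otimes> j)"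
      if "p \<in> carrier R" "j \<in> carrier R" for p j
      using that t Ec[OF a(1)] Ec[OF b(1)] by algebra
    have "(b \<ominus> a) \<otimes> (P as \<otimes> inv (t \<ominus> b)) = P (a # as) \<otimes> inv (t \<ominus> b) \<ominus> P as"
      using u[OF p(2) i(1)] i p by (simp add: P_def)
    also have "\<dots> \<in> D" using Cons.prems(1) p DE(5,7) by (simp add: minus_eq)
    finally have "(b \<ominus> a) \<otimes> (P as \<otimes> inv (t \<ominus> b)) \<in> D" .
    moreover have ba: "b \<ominus> a \<in> E - {\<zero>}"
      using a b Ec subringE(5,7)[OF Er] by (auto simp: minus_eq[symmetric]) (simp add: minus_eq)
    moreover have "inv (b \<ominus> a) \<in> E" "inv (b \<ominus> a) \<otimes> (b \<ominus> a) = \<one>"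
      using subfield_m_inv[OF E ba] by auto
    ultimately have "inv (b \<ominus> a) \<otimes> ((b \<ominus> a) \<otimes> (P as \<otimes> inv (t \<ominus> b))) \<in> D"
      using ED DE(6) by blast
    moreover have "inv (b \<ominus> a) \<otimes> ((b \<ominus> a) \<otimes> (P as \<otimes> inv (t \<ominus> b))) = P as \<otimes> inv (t \<ominus> b)"
      using \<open>inv (b \<ominus> a) \<otimes> (b \<ominus> a) = \<one>\<close> \<open>inv (b \<ominus> a) \<in> E\<close> Ec a b i p by (simp flip: m_assoc)
    ultimately show ?case using Cons.IH a Cons.prems by simp
  qed
  then have "t \<ominus> b \<in> E"
    using transcendental_unit_in_base[OF E t tr, of "t \<ominus> b" "inv (t \<ominus> b)"] taD[OF b(1)] invs[OF b(1)]
    by (simp add: D_def)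
  then have "(t \<ominus> b) \<oplus> b \<in> E" using b subringE(7)[OF Er] by simp
  moreover have "(t \<ominus> b) \<oplus> b = t" using t Ec[OF b(1)] by algebra
  ultimately show False using tE by simp
qed

lemma (in field) Span_mult:
  assumes E: "subfield E R" and c: "set Us \<subseteq> carrier R" "set Vs \<subseteq> carrier R" "set Ws \<subseteq> carrier R"
    and uv: "\<And>u v. u \<in> set Us \<Longrightarrow> v \<in> set Vs \<Longrightarrow> u \<otimes> v \<in> Span E Ws"
    and y: "y \<in> Span E Us" and z: "z \<in> Span E Vs"
  shows "y \<otimes> z \<in> Span E Ws"
proof -
  have Ec: "a \<in> carrier R" if "a \<in> E" for a using that subfieldE(3)[OF E] by blast
  have right: "u \<otimes> z \<in> Span E Ws" if "u \<in> carrier R" "\<And>v. v \<in> set Vs \<Longrightarrow> u \<otimes> v \<in> Span E Ws"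
    "z \<in> Span E Vs" "set Vs \<subseteq> carrier R" for u z Vs
    using that
  proof (induction Vs arbitrary: z)
    case Nil then show ?case using Span_subgroup_props(2)[OF E c(3)] by simp
  next
    case (Cons v Vs)
    then obtain k w where kw: "k \<in> E" "w \<in> Span E Vs" "z = k \<otimes> v \<oplus> w"
      by (auto simp: line_extension_mem_iff)
    have w: "w \<in> carrier R" using kw(2) Span_in_carrier[OF subfieldE(3)[OF E], of Vs] Cons.prems by auto
    have "u \<otimes> z = k \<otimes> (u \<otimes> v) \<oplus> u \<otimes> w" using kw w Cons.prems Ec by (simp add: r_distr m_ac)
    moreover have "u \<otimes> w \<in> Span E Ws" using Cons kw by simp
    moreover have "k \<otimes> (u \<otimes> v) \<in> Span E Ws" using Span_smult_closed[OF E c(3) kw(1)] Cons.prems by simp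
    ultimately show ?case using Span_subgroup_props(3)[OF E c(3)] by simp
  qed
  have zc: "z \<in> carrier R" using z Span_in_carrier[OF subfieldE(3)[OF E] c(2)] by auto
  have "z \<otimes> y \<in> Span E Ws"
  proof (rule right[OF zc _ y c(1)])
    fix u assume u: "u \<in> set Us"
    then have "u \<otimes> z \<in> Span E Ws" using c uv by (intro right[OF _ _ z c(2)]) auto
    then show "z \<otimes> u \<in> Span E Ws" using u c zc m_comm by auto
  qed
  moreover have "y \<in> carrier R" using y Span_in_carrier[OF subfieldE(3)[OF E] c(1)] by auto
  ultimately show ?thesis using zc m_comm by simp
qed

text \<open>
  A monomial in \<open>G\<close> is a list over \<open>G\<close> and a finite set of monomials is a list of such lists. This makes
  the number of finite sets of monomials easy to count.
\<close>

lemma (in field) generate_ring_monomials: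
  assumes E: "subfield E R" and G: "G \<subseteq> carrier R" and y: "y \<in> generate_ring R (E \<union> G)"
  shows "\<exists>ls\<in>lists (lists G). y \<in> Span E (map (\<lambda>l. foldr (\<otimes>) l \<one>) ls)"
proof -
  define mon where "mon = (\<lambda>l. foldr (\<otimes>) l \<one>)"
  have mc: "mon l \<in> carrier R" if "l \<in> lists G" for l
    using that G by (induction l) (auto simp: mon_def)
  have app: "mon (l @ l') = mon l \<otimes> mon l'" if "l \<in> lists G" "l' \<in> lists G" for l l'
    using that(1)
  proof (induction l)
    case Nil then show ?case using mc[OF that(2)] by (simp add: mon_def)
  next
    case (Cons a l)
    then show ?case using mc[OF that(2)] mc[OF Cons(2)] G by (auto simp: mon_def m_assoc subset_iff)
  qed
  have mcs: "set (map mon ls) \<subseteq> carrier R" if "ls \<in> lists (lists G)" for ls using that mc by auto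
  have inc: "mon l \<in> Span E (map mon ls)" if "ls \<in> lists (lists G)" "l \<in> set ls" for l ls
    using Span_base_incl[OF E mcs[OF that(1)]] that(2) by auto
  have "\<exists>ls\<in>lists (lists G). y \<in> Span E (map mon ls)"
    using y
  proof (induction rule: generate_ring.induct)
    case one
    then show ?case using inc[of "[[]]" "[]"] by (intro bexI[of _ "[[]]"]) (auto simp: mon_def)
  next
    case (incl h)
    then show ?case
    proof
      assume h: "h \<in> E"
      have "h \<otimes> mon [] \<in> Span E (map mon [[]])"
        using Span_smult_closed[OF E mcs h inc, of "[[]]" "[]"] by simp
      then show ?thesis using h subfieldE(3)[OF E] by (intro bexI[of _ "[[]]"]) (auto simp: mon_def)
    next
      assume h: "h \<in> G"
      then have "mon [h] \<in> Span E (map mon [[h]])" by (intro inc) auto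
      then show ?thesis using h G by (intro bexI[of _ "[[h]]"]) (auto simp: mon_def)
    qed
  next
    case (a_inv h)
    then show ?case using Span_subgroup_props(4)[OF E mcs] by blast
  next
    case (eng_add h h')
    then obtain ls ls' where l: "ls \<in> lists (lists G)" "h \<in> Span E (map mon ls)"
      "ls' \<in> lists (lists G)" "h' \<in> Span E (map mon ls')" by blast
    then have l3: "ls @ ls' \<in> lists (lists G)" by simp
    have "h \<in> Span E (map mon (ls @ ls'))" "h' \<in> Span E (map mon (ls @ ls'))"
      using mono_Span_append[OF E mcs[OF l(1)] mcs[OF l(3)]] mono_Span_append[OF E mcs[OF l(3)] mcs[OF l(1)]] l
      by auto
    then show ?case using Span_subgroup_props(3)[OF E mcs[OF l3]] l3 by blast
  next
    case (eng_mult h h')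
    then obtain ls ls' where l: "ls \<in> lists (lists G)" "h \<in> Span E (map mon ls)"
      "ls' \<in> lists (lists G)" "h' \<in> Span E (map mon ls')" by blast
    define ms where "ms = concat (map (\<lambda>l. map (\<lambda>l'. l @ l') ls') ls)"
    have ms: "ms \<in> lists (lists G)"
    proof (rule in_listsI, rule ballI)
      fix m assume "m \<in> set ms"
      then obtain a b where "a \<in> set ls" "b \<in> set ls'" "m = a @ b" by (auto simp: ms_def)
      moreover from this have "a \<in> lists G" "b \<in> lists G"
        using in_listsD[OF l(1)] in_listsD[OF l(3)] by blast+
      ultimately show "m \<in> lists G" using append_in_lists_conv by metis
    qed
    have "h \<otimes> h' \<in> Span E (map mon ms)"
    proof (rule Span_mult[OF E mcs[OF l(1)] mcs[OF l(3)] mcs[OF ms] _ l(2,4)])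
      fix u v assume "u \<in> set (map mon ls)" "v \<in> set (map mon ls')"
      then obtain a b where ab: "a \<in> set ls" "b \<in> set ls'" "u = mon a" "v = mon b" by auto
      then have "u \<otimes> v = mon (a @ b)" using l app by (auto simp: in_lists_conv_set)
      moreover have "a @ b \<in> set ms" using ab by (auto simp: ms_def)
      ultimately show "u \<otimes> v \<in> Span E (map mon ms)" using inc[OF ms] by simp
    qed
    then show ?case using ms by blast
  qed
  then show ?thesis by (simp add: mon_def)
qed

text \<open>
  If \<open>t\<close> were transcendental, choose for each \<open>a\<close> in \<open>E\<close> finitely many monomials whose span contains
  \<open>1/(t - a)\<close>. There are only \<open>|G| < |E|\<close> possible choices, so infinitely many \<open>a\<close> share the same one.
  But then a finite-dimensional space contains infinitely many linearly independent elements.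
\<close>

lemma (in field) algebraic_of_few_generators:
  assumes E: "subfield E R" and G: "G \<subseteq> carrier R" "generate_ring R (E \<union> G) = carrier R"
    and inf: "infinite G" and less: "|G| <o |E|" and t: "t \<in> carrier R"
  shows "(algebraic over E) t"
proof (rule ccontr)
  assume "\<not> (algebraic over E) t"
  then have tr: "(transcendental over E) t" by (simp add: over_def)
  note Er = subfieldE(1)[OF E]
  have tE: "t \<notin> E" using algebraic_self[OF Er] tr by (auto simp: over_def)
  define mons where "mons = map (\<lambda>l. foldr (\<otimes>) l \<one>)"
  have invs: "inv (t \<ominus> a) \<in> carrier R" if "a \<in> E" for a
  proof -
    have "a \<in> carrier R" "t \<noteq> a" using that tE subfieldE(3)[OF E] by auto
    then show ?thesis using t field_Units by auto
  qed
  have "\<forall>a\<in>E. \<exists>ls. ls \<in> lists (lists G) \<and> inv (t \<ominus> a) \<in> Span E (mons ls)"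
    using generate_ring_monomials[OF E G(1)] invs G(2) unfolding mons_def by blast
  then obtain c where c: "\<And>a. a \<in> E \<Longrightarrow> c a \<in> lists (lists G)" "\<And>a. a \<in> E \<Longrightarrow> inv (t \<ominus> a) \<in> Span E (mons (c a))"
    by metis
  have "infinite (lists G)" using inf by (metis card_of_lists_infinite card_of_ordIso_finite)
  then have lists: "|lists (lists G)| \<le>o |G|"
    using card_of_lists_infinite[OF inf] card_of_lists_infinite[of "lists G"] ordIso_transitive ordIso_iff_ordLeq by blast
  have "\<exists>ls\<in>lists (lists G). infinite {a \<in> E. c a = ls}"
  proof (rule ccontr)
    assume "\<not> ?thesis"
    then have "\<forall>ls\<in>lists (lists G). |{a \<in> E. c a = ls}| \<le>o |G|"
      using inf finite_ordLess_infinite2 ordLess_imp_ordLeq by blast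
    then have "|\<Union>ls\<in>lists (lists G). {a \<in> E. c a = ls}| \<le>o |G|"
      by (rule card_of_UNION_ordLeq_infinite[OF inf lists])
    moreover have "(\<Union>ls\<in>lists (lists G). {a \<in> E. c a = ls}) = E" using c by auto
    ultimately have "|E| \<le>o |G|" by simp
    then show False using less not_ordLess_ordLeq by blast
  qed
  then obtain ls where ls: "ls \<in> lists (lists G)" "infinite {a \<in> E. c a = ls}" by blast
  have mc: "foldr (\<otimes>) l \<one> \<in> carrier R" if "l \<in> lists G" for l
    using that G(1) by (induction l) auto
  have mcs: "set (mons ls) \<subseteq> carrier R" using ls(1) mc by (auto simp: mons_def)
  obtain n where n: "dimension n E (Span E (mons ls))"
    using Span_finite_dimension[OF E mcs] by (auto simp: finite_dimension_def)
  obtain B where B: "B \<subseteq> {a \<in> E. c a = ls}" "card B = Suc n" "finite B"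
    using infinite_arbitrarily_large[OF ls(2), of "Suc n"] by blast
  obtain as where as: "set as = B" "distinct as" using finite_distinct_list[OF B(3)] by blast
  have "independent E (map (\<lambda>a. inv (t \<ominus> a)) bs)" if "set bs \<subseteq> E" "distinct bs" for bs
    using that
  proof (induction bs)
    case Nil then show ?case by simp
  next
    case (Cons b bs)
    then show ?case
      using inverse_linear_notin_Span[OF E t tr, of bs b] invs by (auto intro!: li_Cons)
  qed
  moreover have "set as \<subseteq> E" using as B by auto
  moreover have "set (map (\<lambda>a. inv (t \<ominus> a)) as) \<subseteq> Span E (mons ls)" using as B c(2) by auto
  ultimately have "length as \<le> n"
    using independent_length_le_dimension[OF E n] as(2) by fastforce
  then show False using as B distinct_card[of as] by simp
qed

section \<open>Specialization to an algebraically closed field\<close>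

text \<open>
  The minimal polynomial of \<open>t\<close> over the image of \<open>L\<close> has a root \<open>b\<close> there. It is then also the
  minimal polynomial of \<open>b\<close>, which is linear, so that \<open>t = b\<close>.
\<close>

lemma (in algebraically_closed) closed_image_algebraic:
  fixes S :: "('c, 'd) ring_scheme"
  assumes S: "field S" and h: "h \<in> ring_hom L S" and t: "t \<in> carrier S"
    and alg: "(ring.algebraic S over (h ` carrier L)) t"
  shows "t \<in> h ` carrier L"
proof -
  interpret S: field S by fact
  interpret h: ring_hom_ring L S h using ring_hom_ringI2[OF ring_axioms S.ring_axioms h] .
  have hK: "subfield (h ` carrier L) S" and inj: "inj_on h (carrier L)"
    using h.img_is_subfield[OF carrier_is_subfield S.one_not_zero] by auto
  note Irr = S.IrrE[OF hK t alg]
  define q where "q = S.Irr (h ` carrier L) t"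
  have q: "q \<in> carrier ((h ` carrier L)[X]\<^bsub>S\<^esub>)" "degree q \<ge> 1"
    using Irr S.pirreducible_degree[OF hK] by (auto simp: q_def)
  then have qs: "set q \<subseteq> h ` carrier L" "lead_coeff q \<noteq> \<zero>\<^bsub>S\<^esub>" "q \<noteq> []"
    by (auto simp: univ_poly_def polynomial_def)
  define p where "p = map (inv_into (carrier L) h) q"
  have hp: "map h p = q" using qs(1) by (auto simp: p_def map_idI f_inv_into_f subset_iff)
  have pL: "set p \<subseteq> carrier L" using qs(1) by (auto simp: p_def inv_into_into)
  have "lead_coeff p \<noteq> \<zero>"
  proof
    assume "lead_coeff p = \<zero>"
    then have "lead_coeff (map h p) = \<zero>\<^bsub>S\<^esub>" using qs(3) by (simp add: p_def hd_map)
    then show False using hp qs by simp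
  qed
  then have p: "p \<in> carrier (poly_ring L)" using pL by (auto simp: univ_poly_def polynomial_def)
  have "degree p \<ge> 1" using q(2) by (simp add: p_def)
  then have "roots p \<noteq> {#}"
    using roots_over_carrier[OF p] by (auto simp: splitted_def)
  then obtain a where a: "a \<in> carrier L" "eval p a = \<zero>"
    using roots_mem_iff_is_root[OF p] unfolding is_root_def by blast
  define b where "b = h a"
  have b: "b \<in> h ` carrier L" "b \<in> carrier S" using a by (auto simp: b_def)
  have qb: "S.eval q b = \<zero>\<^bsub>S\<^esub>"
    using h.eval_hom'[OF a(1) pL] a(2) by (simp add: hp b_def)
  define l where "l = [\<one>\<^bsub>S\<^esub>, \<ominus>\<^bsub>S\<^esub> b]"
  have l: "l \<in> carrier ((h ` carrier L)[X]\<^bsub>S\<^esub>)"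
    using subringE(3,5)[OF subfieldE(1)[OF hK]] b by (auto simp: l_def univ_poly_def polynomial_def)
  have lb: "S.eval l y = y \<ominus>\<^bsub>S\<^esub> b" if "y \<in> carrier S" for y using that b by (simp add: l_def S.minus_eq)
  have "q = l"
  proof (rule ex1E[OF S.minimal_polynomial_is_unique[OF hK b(2) S.algebraic_self[OF subfieldE(1)[OF hK] b(1)]]], elim conjE)
    fix m assume "\<forall>y. (y \<in> carrier ((h ` carrier L)[X]\<^bsub>S\<^esub>) \<and> pirreducible\<^bsub>S\<^esub> (h ` carrier L) y \<and> S.eval y b = \<zero>\<^bsub>S\<^esub> \<and> lead_coeff y = \<one>\<^bsub>S\<^esub>) \<longrightarrow> y = m"
    then have m: "y = m" if "y \<in> carrier ((h ` carrier L)[X]\<^bsub>S\<^esub>)" "pirreducible\<^bsub>S\<^esub> (h ` carrier L) y"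
      "S.eval y b = \<zero>\<^bsub>S\<^esub>" "lead_coeff y = \<one>\<^bsub>S\<^esub>" for y using that by blast
    have "q = m" using m[of q] Irr qb by (simp add: q_def)
    moreover have "l = m"
      using m[of l] l lb[OF b(2)] b S.degree_one_imp_pirreducible[OF hK l] by (simp add: l_def S.r_neg S.minus_eq)
    ultimately show "q = l" by simp
  qed
  then have "t \<ominus>\<^bsub>S\<^esub> b = \<zero>\<^bsub>S\<^esub>" using Irr(4) lb[OF t] by (simp add: q_def)
  then show ?thesis using b t by simp
qed

lemma (in cring) exists_maximal_ideal:
  assumes "\<one> \<noteq> \<zero>"
  obtains m where "maximalideal m R"
proof -
  define A where "A = {I. ideal I R \<and> \<one> \<notin> I}"
  have "\<exists>m\<in>A. \<forall>I\<in>A. m \<subseteq> I \<longrightarrow> I = m"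
  proof (rule subset_Zorn_nonempty)
    show "A \<noteq> {}" using zeroideal assms by (auto simp: A_def)
    fix C assume C: "C \<noteq> {}" "subset.chain A C"
    then have "subset.chain {I. ideal I R} C" by (auto simp: subset_chain_def A_def)
    then have "ideal (\<Union>C) R" using chain_Union_is_ideal[of C] C(1) by simp
    then show "\<Union>C \<in> A" using C(2) by (auto simp: subset_chain_def A_def)
  qed
  then obtain m where m: "m \<in> A" and max: "\<And>I. I \<in> A \<Longrightarrow> m \<subseteq> I \<Longrightarrow> I = m" by blast
  have "maximalideal m R"
  proof (rule maximalidealI)
    show "ideal m R" "carrier R \<noteq> m" using m by (auto simp: A_def)
    fix J assume J: "ideal J R" "m \<subseteq> J" "J \<subseteq> carrier R"
    show "J = m \<or> J = carrier R"
    proof (cases "\<one> \<in> J")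
      case True
      then show ?thesis using ideal.one_imp_carrier[OF J(1)] by simp
    next
      case False
      then show ?thesis using max[of J] J by (auto simp: A_def)
    qed
  qed
  then show ?thesis by (rule that)
qed

text \<open>
  Let \<open>m\<close> be a maximal ideal of the ring \<open>R\<close> generated by \<open>k\<close> and \<open>G\<close>. Its residue field is
  algebraic over the image of \<open>k\<close>, hence equal to it, so that \<open>R = m + k\<close>. A \<open>k\<close>-linear functional
  on \<open>F\<close> that kills \<open>m\<close> and fixes \<open>1\<close> is on \<open>R\<close> the residue map, and so it is
  multiplicative there.
\<close>

theorem exists_specialization:
  fixes F :: "'a ring" (structure)
  assumes "field F" and k: "subfield k F" and closed: "algebraically_closed (F\<lparr>carrier := k\<rparr>)"
    and G: "G \<subseteq> carrier F" "finite G \<or> |G| <o |k|"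
  obtains \<phi> where "\<And>x. x \<in> carrier F \<Longrightarrow> \<phi> x \<in> k"
    "\<And>x y. x \<in> carrier F \<Longrightarrow> y \<in> carrier F \<Longrightarrow> \<phi> (x \<oplus> y) = \<phi> x \<oplus> \<phi> y"
    "\<And>c x. c \<in> k \<Longrightarrow> x \<in> carrier F \<Longrightarrow> \<phi> (c \<otimes> x) = c \<otimes> \<phi> x"
    "\<phi> \<one> = \<one>"
    "\<And>x y. x \<in> generate_ring F (k \<union> G) \<Longrightarrow> y \<in> generate_ring F (k \<union> G) \<Longrightarrow> \<phi> (x \<otimes> y) = \<phi> x \<otimes> \<phi> y"
proof -
  interpret field F by fact
  have kc: "c \<in> carrier F" if "c \<in> k" for c using that subfieldE(3)[OF k] by blast
  have kG: "k \<union> G \<subseteq> carrier F" using kc G by auto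
  define R where "R = generate_ring F (k \<union> G)"
  have R: "subring R F" unfolding R_def using kG by (rule generate_ring_is_subring)
  note RE = subringE[OF R]
  have kR: "k \<union> G \<subseteq> R" by (auto simp: R_def intro: generate_ring.incl)
  define A where "A = F\<lparr>carrier := R\<rparr>"
  have "domain A" unfolding A_def using R by (rule subring_is_domain)
  then interpret A: domain A .
  have A_simps [simp]: "carrier A = R" "monoid.mult A = monoid.mult F" "add A = add F" "\<one>\<^bsub>A\<^esub> = \<one>" "\<zero>\<^bsub>A\<^esub> = \<zero>"
    by (simp_all add: A_def)
  obtain m where m: "maximalideal m A" using A.exists_maximal_ideal[OF A.one_not_zero] by blast
  interpret m: maximalideal m A by fact
  define Q where "Q = A Quot m"
  have "field Q" unfolding Q_def using A.is_cring by (rule m.quotient_is_field)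
  then interpret Q: field Q .
  define h where "h = (+>\<^bsub>A\<^esub>) m"
  have hom: "h \<in> ring_hom A Q" unfolding h_def Q_def by (rule m.rcos_ring_hom)
  have hsurj: "h ` R = carrier Q" unfolding h_def Q_def FactRing_def A_RCOSETS_def' by auto
  interpret h: ring_hom_ring A Q h using ring_hom_ringI2[OF A.ring_axioms Q.ring_axioms hom] .
  have "subfield k A"
    using ring.subfield_iff(1)[OF A.ring_axioms, of k] subfield_iff(2)[OF k] kR by (simp add: A_def)
  then have hk: "subfield (h ` k) Q" and hinj: "inj_on h k"
    using h.img_is_subfield Q.one_not_zero by auto
  have hG: "h ` G \<subseteq> carrier Q" using kR hsurj by auto
  have hgen: "h y \<in> generate_ring Q (h ` k \<union> h ` G)" if "y \<in> R" for y
    using that unfolding R_def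
  proof (induction rule: generate_ring.induct)
    case one
    show ?case using generate_ring.one[of Q] h.hom_one by simp
  next
    case (incl y) then show ?case by (auto intro: generate_ring.incl)
  next
    case (a_inv y)
    have "y \<in> R" using a_inv by (simp add: R_def)
    then have "\<ominus> y = \<ominus>\<^bsub>A\<^esub> y"
      using A.minus_equality[of "\<ominus> y" y] RE(1,5) by (auto simp: l_neg)
    then show ?case using generate_ring.a_inv[OF a_inv(2)] h.hom_a_inv \<open>y \<in> R\<close> by simp
  next
    case (eng_add y z)
    then show ?case using generate_ring.eng_add[OF eng_add(3,4)] h.hom_add[of y z] by (simp add: R_def)
  next
    case (eng_mult y z)
    then show ?case using generate_ring.eng_mult[OF eng_mult(3,4)] h.hom_mult[of y z] by (simp add: R_def)
  qed
  have Q_gen: "generate_ring Q (h ` k \<union> h ` G) = carrier Q"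
  proof
    show "generate_ring Q (h ` k \<union> h ` G) \<subseteq> carrier Q"
      using hG subfieldE(3)[OF hk] by (intro Q.generate_ring_incl) auto
    show "carrier Q \<subseteq> generate_ring Q (h ` k \<union> h ` G)"
      unfolding hsurj[symmetric] using hgen by (rule image_subsetI)
  qed
  have alg: "(Q.algebraic over (h ` k)) t" if t: "t \<in> carrier Q" for t
  proof (cases "finite (h ` G)")
    case True
    then obtain xs where xs: "set xs = h ` G" using finite_list by blast
    have "Q.finite_dimension (h ` k) (carrier Q)"
      using zariski_lemma[OF Q.field_axioms hk, of xs] xs hG Q_gen by simp
    then show ?thesis using Q.finite_dimension_imp_algebraic[OF hk Q.carrier_is_subring] t by simp
  next
    case False
    have "|h ` G| \<le>o |G|" by (rule card_of_image)
    also have "|G| <o |k|" using G(2) False by auto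
    also have "|k| =o |h ` k|" using card_of_ordIso hinj by (metis bij_betw_imageI)
    finally have "|h ` G| <o |h ` k|" .
    then show ?thesis
      using Q.algebraic_of_few_generators[OF hk hG Q_gen False _ t] by simp
  qed
  interpret K: algebraically_closed "F\<lparr>carrier := k\<rparr>" by fact
  have hK: "h \<in> ring_hom (F\<lparr>carrier := k\<rparr>) Q"
    using hom kR by (auto simp: ring_hom_def A_def)
  have onto: "\<exists>c\<in>k. h r = h c" if "r \<in> R" for r
    using K.closed_image_algebraic[OF Q.field_axioms hK, of "h r"] alg[of "h r"] hsurj that by auto
  have mR: "m \<subseteq> R" using m.a_subset by simp
  have dec: "\<exists>c\<in>k. \<exists>i\<in>m. r = i \<oplus> c" if r: "r \<in> R" for r
  proof -
    obtain c where c: "c \<in> k" "h r = h c" using onto[OF r] by blast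
    have "r \<in> m +>\<^bsub>A\<^esub> r"
      using m.zero_closed r A.l_zero[of r] by (force simp: a_r_coset_def' simp del: A.l_zero)
    then have "r \<in> m +>\<^bsub>A\<^esub> c" using c by (simp add: h_def)
    then show ?thesis using c by (auto simp: a_r_coset_def')
  qed
  have one_m: "\<one> \<notin> m" using m.I_notcarr m.one_imp_carrier by auto
  obtain \<phi> where \<phi>: "\<And>x. x \<in> carrier F \<Longrightarrow> \<phi> x \<in> k"
    "\<And>x y. x \<in> carrier F \<Longrightarrow> y \<in> carrier F \<Longrightarrow> \<phi> (x \<oplus> y) = \<phi> x \<oplus> \<phi> y"
    "\<And>c x. c \<in> k \<Longrightarrow> x \<in> carrier F \<Longrightarrow> \<phi> (c \<otimes> x) = c \<otimes> \<phi> x"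
    "\<phi> \<one> = \<one>" "\<And>x. x \<in> m \<Longrightarrow> \<phi> x = \<zero>"
  proof (rule exists_linear_functional[OF k _ _ _ _ one_m])
    show "m \<subseteq> carrier F" using mR RE(1) by auto
    show "\<zero> \<in> m" using m.zero_closed by simp
    show "x \<oplus> y \<in> m" if "x \<in> m" "y \<in> m" for x y using m.a_closed that by simp
    show "c \<otimes> x \<in> m" if "c \<in> k" "x \<in> m" for c x using m.I_l_closed[of x c] that kR by auto
  qed auto
  have phik: "\<phi> c = c" if "c \<in> k" for c using \<phi>(3)[of c \<one>] \<phi>(4) kc that by simp
  show thesis
  proof (rule that[OF \<phi>(1-4)])
    fix x y assume "x \<in> generate_ring F (k \<union> G)" "y \<in> generate_ring F (k \<union> G)"
    then have xy: "x \<in> R" "y \<in> R" by (auto simp: R_def)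
    obtain c i where c: "c \<in> k" "i \<in> m" "x = i \<oplus> c" using dec[OF xy(1)] by blast
    obtain d j where d: "d \<in> k" "j \<in> m" "y = j \<oplus> d" using dec[OF xy(2)] by blast
    have car: "c \<in> carrier F" "d \<in> carrier F" "i \<in> carrier F" "j \<in> carrier F" "y \<in> carrier F"
      using c d kc mR RE(1) xy by auto
    have cd: "\<phi> x = c" "\<phi> y = d" using c d \<phi>(2,5) phik car by auto
    have mem: "i \<otimes> y \<in> m" "c \<otimes> j \<in> m"
      using m.I_r_closed[of i y] m.I_l_closed[of j c] c d xy kR by auto
    have "x \<otimes> y = (i \<otimes> y \<oplus> c \<otimes> j) \<oplus> c \<otimes> d"
      unfolding c(3) using car by (subst (2) d(3), subst d(3)) (algebra)
    moreover have "i \<otimes> y \<oplus> c \<otimes> j \<in> m" using m.a_closed[OF mem] by simp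
    ultimately have "\<phi> (x \<otimes> y) = \<phi> (c \<otimes> d)"
      using \<phi>(2)[of "i \<otimes> y \<oplus> c \<otimes> j" "c \<otimes> d"] \<phi>(1)[of "c \<otimes> d"] \<phi>(5) car kc by simp
    also have "\<dots> = c \<otimes> d" using c d subringE(6)[OF subfieldE(1)[OF k]] phik by simp
    finally show "\<phi> (x \<otimes> y) = \<phi> x \<otimes> \<phi> y" using cd by simp
  qed
qed

section \<open>Extension of scalars to a field\<close>

lemma additive_zero:
  assumes "abelian_group M" "abelian_group N" "f \<in> carrier M \<rightarrow> carrier N"
    and "\<And>x y. x \<in> carrier M \<Longrightarrow> y \<in> carrier M \<Longrightarrow> f (x \<oplus>\<^bsub>M\<^esub> y) = f x \<oplus>\<^bsub>N\<^esub> f y"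
  shows "f \<zero>\<^bsub>M\<^esub> = \<zero>\<^bsub>N\<^esub>"
proof -
  interpret M: abelian_group M by fact
  interpret N: abelian_group N by fact
  have "f \<zero>\<^bsub>M\<^esub> \<oplus>\<^bsub>N\<^esub> f \<zero>\<^bsub>M\<^esub> = f \<zero>\<^bsub>M\<^esub>" using assms(4)[of "\<zero>\<^bsub>M\<^esub>" "\<zero>\<^bsub>M\<^esub>"] by simp
  moreover have "f \<zero>\<^bsub>M\<^esub> \<in> carrier N" using assms(3) by auto
  ultimately show ?thesis by simp
qed

text \<open>
  \<open>M\<close> is an \<open>F\<close>-algebra identified by \<open>\<tau>\<close> with \<open>A \<otimes>\<^sub>K F\<close>. That \<open>M\<close> is an algebra has a useful
  effect: the operations of the tensor product, which are unions over all representatives, have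
  values that are classes, as they are images of elements of \<open>M\<close>. Each such union contains the class
  computed from any one choice of representatives, and so equals it: well-definedness follows from
  closure.
\<close>

locale scalar_extension =
  fixes F K :: "'u ring"
    and A :: "('u, 'v) module"
    and M :: "('u, 'm) module"
    and \<tau> :: "'m \<Rightarrow> ('v \<times> 'u \<Rightarrow>\<^sub>0 int) set"
  assumes F_field: "field F"
    and K_subfield: "subfield (carrier K) F"
    and K_eq: "K = F\<lparr>carrier := carrier K\<rparr>"
    and A_algebra: "nonassoc_algebra K A"
    and M_algebra: "nonassoc_algebra F M"
    and tau: "\<tau> \<in> nalg_iso F M (tensor_algebra K A (self_algebra F))"
begin

sublocale F: field F by (rule F_field)
sublocale A: nonassoc_algebra K A by (rule A_algebra)
sublocale M: nonassoc_algebra F M by (rule M_algebra)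

lemma K_ops [simp]:
  "add K = add F" "monoid.mult K = monoid.mult F" "\<one>\<^bsub>K\<^esub> = \<one>\<^bsub>F\<^esub>" "\<zero>\<^bsub>K\<^esub> = \<zero>\<^bsub>F\<^esub>"
  by (subst K_eq, simp)+

lemma K_in_F: "k \<in> carrier K \<Longrightarrow> k \<in> carrier F"
  using subfieldE(3)[OF K_subfield] by blast

abbreviation T where "T \<equiv> tensor_algebra K A (self_algebra F)"
abbreviation free where "free \<equiv> tensor_free A (self_algebra F)"
abbreviation kern where "kern \<equiv> tensor_kernel K A (self_algebra F)"
abbreviation cls where "cls \<equiv> tensor_class K A (self_algebra F)"

lemma free_def': "free = free_Abelian_group (carrier A \<times> carrier F)"
  by (simp add: tensor_free_def self_algebra_def)

lemma keys_iff: "x \<in> carrier free \<longleftrightarrow> Poly_Mapping.keys x \<subseteq> carrier A \<times> carrier F"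
  by (simp add: free_def')

lemma frag_in_free: "a \<in> carrier A \<Longrightarrow> r \<in> carrier F \<Longrightarrow> frag_of (a, r) \<in> carrier free"
  by (simp add: keys_iff)

lemma minus_in_free: "x \<in> carrier free \<Longrightarrow> y \<in> carrier free \<Longrightarrow> x - y \<in> carrier free"
  using keys_diff[of x y] by (auto simp: keys_iff)

lemma add_in_free: "x \<in> carrier free \<Longrightarrow> y \<in> carrier free \<Longrightarrow> x + y \<in> carrier free"
  using keys_add[of x y] by (auto simp: keys_iff)

sublocale free: comm_group free
  unfolding free_def' by (rule abelian_free_Abelian_group)

lemma tensor_relationE:
  assumes "x \<in> tensor_relations K A (self_algebra F)"
  obtains (add_l) a b r where "a \<in> carrier A" "b \<in> carrier A" "r \<in> carrier F"
      "x = frag_of (a \<oplus>\<^bsub>A\<^esub> b, r) - (frag_of (a, r) + frag_of (b, r))"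
  | (add_r) a r s where "a \<in> carrier A" "r \<in> carrier F" "s \<in> carrier F"
      "x = frag_of (a, r \<oplus>\<^bsub>F\<^esub> s) - (frag_of (a, r) + frag_of (a, s))"
  | (balanced) k a r where "k \<in> carrier K" "a \<in> carrier A" "r \<in> carrier F"
      "x = frag_of (k \<odot>\<^bsub>A\<^esub> a, r) - frag_of (a, k \<otimes>\<^bsub>F\<^esub> r)"
proof -
  have ops: "carrier (self_algebra F) = carrier F" "add (self_algebra F) = add F"
    "smult (self_algebra F) = monoid.mult F"
    by (simp_all add: self_algebra_def)
  show thesis
    using assms unfolding tensor_relations_def ops diff_diff_eq
  proof (elim UnE CollectE exE conjE, goal_cases)
    case (1 a b r) then show ?case using add_l by blast
  next
    case (2 a r s) then show ?case using add_r by blast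
  next
    case (3 k a r) then show ?case using balanced by blast
  qed
qed

lemma relations_in_free: "tensor_relations K A (self_algebra F) \<subseteq> carrier free"
proof
  fix x assume "x \<in> tensor_relations K A (self_algebra F)"
  then show "x \<in> carrier free"
    by (cases rule: tensor_relationE) (simp_all add: minus_in_free add_in_free frag_in_free K_in_F)
qed

lemma subgroup_kern: "subgroup kern free"
  unfolding tensor_kernel_def by (rule free.generate_is_subgroup[OF relations_in_free])

lemma normal_kern: "kern \<lhd> free"
  by (rule free.subgroup_imp_normal[OF subgroup_kern])

lemma carrier_T: "carrier T = cls ` carrier free"
  by (auto simp: tensor_algebra_def FactGroup_def RCOSETS_def tensor_class_def)

lemma T_add: "x \<in> carrier free \<Longrightarrow> y \<in> carrier free \<Longrightarrow> cls x \<oplus>\<^bsub>T\<^esub> cls y = cls (x + y)"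
  using normal.rcos_sum[OF normal_kern, of x y]
  by (simp add: tensor_algebra_def FactGroup_def tensor_class_def free_def')

lemma self_in_cls: "x \<in> carrier free \<Longrightarrow> x \<in> cls x"
  unfolding tensor_class_def by (rule free.rcos_self[OF _ subgroup_kern])

lemma cls_eqI: "y \<in> cls x \<Longrightarrow> x \<in> carrier free \<Longrightarrow> cls y = cls x"
  unfolding tensor_class_def using free.repr_independence[OF _ _ subgroup_kern] by metis

lemma cls_eq_diff:
  assumes "x - y \<in> kern" "x \<in> carrier free" "y \<in> carrier free"
  shows "cls x = cls y"
proof (rule cls_eqI)
  show "x \<in> cls y"
    unfolding tensor_class_def r_coset_def using assms(1) by (force simp: free_def')
qed fact

lemma tau_bij: "bij_betw \<tau> (carrier M) (carrier T)"
  using tau by (simp add: nalg_iso_def)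

lemma tau_closed: "x \<in> carrier M \<Longrightarrow> \<tau> x \<in> carrier T"
  using tau_bij by (auto simp: bij_betw_def)

lemma tau_hom:
  "x \<in> carrier M \<Longrightarrow> y \<in> carrier M \<Longrightarrow> \<tau> (x \<oplus>\<^bsub>M\<^esub> y) = \<tau> x \<oplus>\<^bsub>T\<^esub> \<tau> y"
  "x \<in> carrier M \<Longrightarrow> y \<in> carrier M \<Longrightarrow> \<tau> (x \<otimes>\<^bsub>M\<^esub> y) = \<tau> x \<otimes>\<^bsub>T\<^esub> \<tau> y"
  "s \<in> carrier F \<Longrightarrow> x \<in> carrier M \<Longrightarrow> \<tau> (s \<odot>\<^bsub>M\<^esub> x) = s \<odot>\<^bsub>T\<^esub> \<tau> x"
  using tau by (auto simp: nalg_iso_def nalg_hom_def)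

text \<open>
The element of \<open>M\<close> that corresponds to \<open>a \<otimes> r\<close>.
\<close>

definition tens :: "'v \<Rightarrow> 'u \<Rightarrow> 'm"
  where "tens a r = inv_into (carrier M) \<tau> (cls (frag_of (a, r)))"

lemma tau_tens: "a \<in> carrier A \<Longrightarrow> r \<in> carrier F \<Longrightarrow> \<tau> (tens a r) = cls (frag_of (a, r))"
  unfolding tens_def using tau_bij carrier_T frag_in_free
  by (intro f_inv_into_f) (auto simp: bij_betw_def)

lemma tens_closed [simp]: "a \<in> carrier A \<Longrightarrow> r \<in> carrier F \<Longrightarrow> tens a r \<in> carrier M"
  unfolding tens_def using tau_bij carrier_T frag_in_free
  by (intro inv_into_into) (auto simp: bij_betw_def)

lemma tau_inj: "x \<in> carrier M \<Longrightarrow> y \<in> carrier M \<Longrightarrow> \<tau> x = \<tau> y \<Longrightarrow> x = y"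
  using tau_bij by (auto simp: bij_betw_def dest: inj_onD)

lemma relation_in_kern: "x \<in> tensor_relations K A (self_algebra F) \<Longrightarrow> x \<in> kern"
  unfolding tensor_kernel_def by (rule generate.incl)

lemma tens_add_l:
  assumes "a \<in> carrier A" "b \<in> carrier A" "r \<in> carrier F"
  shows "tens (a \<oplus>\<^bsub>A\<^esub> b) r = tens a r \<oplus>\<^bsub>M\<^esub> tens b r"
proof (rule tau_inj)
  have "frag_of (a \<oplus>\<^bsub>A\<^esub> b, r) - frag_of (a, r) - frag_of (b, r) \<in> tensor_relations K A (self_algebra F)"
    unfolding tensor_relations_def using assms by (auto simp: self_algebra_def)
  then have "frag_of (a \<oplus>\<^bsub>A\<^esub> b, r) - (frag_of (a, r) + frag_of (b, r)) \<in> kern"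
    using relation_in_kern by (simp add: diff_diff_eq)
  then show "\<tau> (tens (a \<oplus>\<^bsub>A\<^esub> b) r) = \<tau> (tens a r \<oplus>\<^bsub>M\<^esub> tens b r)"
    using cls_eq_diff[of _ "frag_of (a, r) + frag_of (b, r)"] assms
    by (simp add: tau_hom tau_tens T_add frag_in_free add_in_free)
qed (use assms in auto)

lemma tens_balanced:
  assumes "k \<in> carrier K" "a \<in> carrier A" "r \<in> carrier F"
  shows "tens (k \<odot>\<^bsub>A\<^esub> a) r = tens a (k \<otimes>\<^bsub>F\<^esub> r)"
proof (rule tau_inj)
  have "frag_of (k \<odot>\<^bsub>A\<^esub> a, r) - frag_of (a, k \<otimes>\<^bsub>F\<^esub> r) \<in> tensor_relations K A (self_algebra F)"
    unfolding tensor_relations_def using assms by (auto simp: self_algebra_def)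
  then show "\<tau> (tens (k \<odot>\<^bsub>A\<^esub> a) r) = \<tau> (tens a (k \<otimes>\<^bsub>F\<^esub> r))"
    using cls_eq_diff[OF relation_in_kern] assms K_in_F by (simp add: tau_tens frag_in_free)
qed (use assms K_in_F in auto)

lemma tens_smult:
  assumes "a \<in> carrier A" "r \<in> carrier F" "s \<in> carrier F"
  shows "s \<odot>\<^bsub>M\<^esub> tens a r = tens a (s \<otimes>\<^bsub>F\<^esub> r)"
proof (rule tau_inj)
  let ?U = "cls (frag_of (a, r))"
  have "cls (frag_of (a, s \<otimes>\<^bsub>F\<^esub> r)) \<subseteq> s \<odot>\<^bsub>T\<^esub> ?U"
    using self_in_cls[OF frag_in_free[OF assms(1,2)]]
    by (force simp: tensor_algebra_def self_algebra_def)
  moreover have "s \<odot>\<^bsub>T\<^esub> ?U \<in> carrier T"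
    using tau_hom(3)[of s "tens a r"] tau_closed[of "s \<odot>\<^bsub>M\<^esub> tens a r"] assms by (simp add: tau_tens)
  then obtain z where z: "z \<in> carrier free" "s \<odot>\<^bsub>T\<^esub> ?U = cls z" using carrier_T by auto
  ultimately have "cls (frag_of (a, s \<otimes>\<^bsub>F\<^esub> r)) = s \<odot>\<^bsub>T\<^esub> ?U"
    using cls_eqI[of "frag_of (a, s \<otimes>\<^bsub>F\<^esub> r)" z] self_in_cls[of "frag_of (a, s \<otimes>\<^bsub>F\<^esub> r)"] frag_in_free assms by auto
  then show "\<tau> (s \<odot>\<^bsub>M\<^esub> tens a r) = \<tau> (tens a (s \<otimes>\<^bsub>F\<^esub> r))"
    using assms by (simp add: tau_hom tau_tens)
qed (use assms in auto)

lemma tens_mult: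
  assumes "a \<in> carrier A" "b \<in> carrier A" "r \<in> carrier F" "s \<in> carrier F"
  shows "tens a r \<otimes>\<^bsub>M\<^esub> tens b s = tens (a \<otimes>\<^bsub>A\<^esub> b) (r \<otimes>\<^bsub>F\<^esub> s)"
proof (rule tau_inj)
  let ?U = "cls (frag_of (a, r))" and ?V = "cls (frag_of (b, s))" and ?p = "frag_of (a \<otimes>\<^bsub>A\<^esub> b, r \<otimes>\<^bsub>F\<^esub> s)"
  have "frag_of (a, r) \<in> ?U" "frag_of (b, s) \<in> ?V"
    using self_in_cls frag_in_free assms by auto
  then have "cls ?p \<subseteq> ?U \<otimes>\<^bsub>T\<^esub> ?V"
    by (force simp: tensor_algebra_def self_algebra_def)
  moreover have "?U \<otimes>\<^bsub>T\<^esub> ?V \<in> carrier T"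
    using tau_hom(2)[of "tens a r" "tens b s"] tau_closed[of "tens a r \<otimes>\<^bsub>M\<^esub> tens b s"] assms M.mult_closed
    by (simp add: tau_tens)
  then obtain z where z: "z \<in> carrier free" "?U \<otimes>\<^bsub>T\<^esub> ?V = cls z" using carrier_T by auto
  ultimately have "cls ?p = ?U \<otimes>\<^bsub>T\<^esub> ?V"
    using cls_eqI[of ?p z] self_in_cls[of ?p] frag_in_free assms A.mult_closed by auto
  then show "\<tau> (tens a r \<otimes>\<^bsub>M\<^esub> tens b s) = \<tau> (tens (a \<otimes>\<^bsub>A\<^esub> b) (r \<otimes>\<^bsub>F\<^esub> s))"
    using assms A.mult_closed by (simp add: tau_hom tau_tens)
qed (use assms A.mult_closed M.mult_closed in auto)

text \<open>
The canonical map from \<open>A\<close> to \<open>A \<otimes>\<^sub>K F\<close>.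
\<close>

definition incl :: "'v \<Rightarrow> 'm"
  where "incl a = tens a \<one>\<^bsub>F\<^esub>"

lemma incl_closed [simp]: "a \<in> carrier A \<Longrightarrow> incl a \<in> carrier M"
  by (simp add: incl_def)

lemma tens_eq: "a \<in> carrier A \<Longrightarrow> r \<in> carrier F \<Longrightarrow> tens a r = r \<odot>\<^bsub>M\<^esub> incl a"
  by (simp add: incl_def tens_smult)

lemma incl_add: "a \<in> carrier A \<Longrightarrow> b \<in> carrier A \<Longrightarrow> incl (a \<oplus>\<^bsub>A\<^esub> b) = incl a \<oplus>\<^bsub>M\<^esub> incl b"
  by (simp add: incl_def tens_add_l)

lemma incl_mult: "a \<in> carrier A \<Longrightarrow> b \<in> carrier A \<Longrightarrow> incl (a \<otimes>\<^bsub>A\<^esub> b) = incl a \<otimes>\<^bsub>M\<^esub> incl b"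
  by (simp add: incl_def tens_mult)

lemma incl_smult: "k \<in> carrier K \<Longrightarrow> a \<in> carrier A \<Longrightarrow> incl (k \<odot>\<^bsub>A\<^esub> a) = k \<odot>\<^bsub>M\<^esub> incl a"
  by (simp add: incl_def tens_smult tens_balanced K_in_F)

lemma incl_zero: "incl \<zero>\<^bsub>A\<^esub> = \<zero>\<^bsub>M\<^esub>"
  by (rule additive_zero[OF A.abelian_group_axioms M.abelian_group_axioms]) (auto simp: incl_add)

text \<open>
  For a subring \<open>R\<close> of \<open>F\<close> that contains \<open>K\<close> this is the copy of \<open>A \<otimes>\<^sub>K R\<close> inside \<open>A \<otimes>\<^sub>K F\<close>.
\<close>

abbreviation form :: "'u set \<Rightarrow> 'm set"
  where "form R \<equiv> lin_span R M (incl ` carrier A)"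

lemma form_in_carrier: "R \<subseteq> carrier F \<Longrightarrow> x \<in> form R \<Longrightarrow> x \<in> carrier M"
  using M.lin_span_in_carrier[of R "incl ` carrier A"] by (auto simp: image_subset_iff)

text \<open>
  The tensor product is generated by pure tensors; negatives are absorbed by the scalars.
\<close>

lemma form_carrier: "form (carrier F) = carrier M"
proof
  show "form (carrier F) \<subseteq> carrier M" using form_in_carrier by blast
  show "carrier M \<subseteq> form (carrier F)"
  proof
    fix x assume x: "x \<in> carrier M"
    \<comment> \<open>The induction for free abelian groups has a step for differences, the one for spans has none.\<close>
    have minus: "\<ominus>\<^bsub>M\<^esub> y \<in> form (carrier F)" if "y \<in> form (carrier F)" for y
    proof -
      have "\<ominus>\<^bsub>M\<^esub> y = (\<ominus>\<^bsub>F\<^esub> \<one>\<^bsub>F\<^esub>) \<odot>\<^bsub>M\<^esub> y"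
        using form_in_carrier[OF _ that] by (simp add: M.smult_l_minus)
      then show ?thesis using that by (simp add: lin_span.smult)
    qed
    have "\<forall>y\<in>carrier M. \<tau> y = cls z \<longrightarrow> y \<in> form (carrier F)" if "z \<in> carrier free" for z
    proof (rule free_Abelian_group_induct[of z "carrier A \<times> carrier F"], goal_cases)
      case 1
      then show ?case using that by (simp add: keys_iff)
    next
      case 2
      show ?case
      proof (intro ballI impI)
        fix y assume y: "y \<in> carrier M" "\<tau> y = cls 0"
        have "cls 0 \<oplus>\<^bsub>T\<^esub> cls 0 = cls 0" using T_add[of 0 0] by (simp add: keys_iff)
        then have "\<tau> (y \<oplus>\<^bsub>M\<^esub> y) = \<tau> y" using y by (simp add: tau_hom)
        then have "y \<oplus>\<^bsub>M\<^esub> y = y" using y tau_inj by simp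
        then have "y = \<zero>\<^bsub>M\<^esub>" using y by simp
        then show "y \<in> form (carrier F)" by (simp add: lin_span.zero)
      qed
    next
      case (3 u v)
      then have uv: "u \<in> carrier free" "v \<in> carrier free" "u - v \<in> carrier free"
        using minus_in_free by (auto simp: keys_iff)
      show ?case
      proof (intro ballI impI)
        fix y assume y: "y \<in> carrier M" "\<tau> y = cls (u - v)"
        have "cls v \<in> \<tau> ` carrier M" using tau_bij carrier_T uv by (auto simp: bij_betw_def)
        then obtain w where w: "w \<in> carrier M" "\<tau> w = cls v" by auto
        have "\<tau> (y \<oplus>\<^bsub>M\<^esub> w) = cls u" using y w uv by (simp add: tau_hom T_add)
        then have "y \<oplus>\<^bsub>M\<^esub> w \<in> form (carrier F)" using 3(3) y w by simp
        moreover have "\<ominus>\<^bsub>M\<^esub> w \<in> form (carrier F)" using 3(4) w minus by simp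
        moreover have "y = (y \<oplus>\<^bsub>M\<^esub> w) \<oplus>\<^bsub>M\<^esub> \<ominus>\<^bsub>M\<^esub> w"
          using y w by (simp add: M.a_assoc M.r_neg)
        ultimately show "y \<in> form (carrier F)" using lin_span.add by metis
      qed
    next
      case (4 p)
      then obtain a r where p: "p = (a, r)" "a \<in> carrier A" "r \<in> carrier F" by auto
      show ?case
      proof (intro ballI impI)
        fix y assume y: "y \<in> carrier M" "\<tau> y = cls (frag_of p)"
        then have "y = tens a r" using p tau_inj by (simp add: tau_tens)
        then have "y = r \<odot>\<^bsub>M\<^esub> incl a" using p by (simp add: tens_eq)
        then show "y \<in> form (carrier F)"
          using lin_span.smult[OF p(3) lin_span.incl[OF imageI[OF p(2)]]] by simp
      qed
    qed
    moreover obtain z where "z \<in> carrier free" "\<tau> x = cls z"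
      using tau_closed[OF x] carrier_T by auto
    ultimately show "x \<in> form (carrier F)" using x by blast
  qed
qed

text \<open>
  The universal properties of free abelian groups and of quotient groups, composed with \<open>\<tau>\<close>.
\<close>

lemma universal_property:
  assumes B: "abelian_group B"
    and closed: "\<And>a r. a \<in> carrier A \<Longrightarrow> r \<in> carrier F \<Longrightarrow> \<beta> a r \<in> carrier B"
    and add_l: "\<And>a b r. a \<in> carrier A \<Longrightarrow> b \<in> carrier A \<Longrightarrow> r \<in> carrier F \<Longrightarrow>
      \<beta> (a \<oplus>\<^bsub>A\<^esub> b) r = \<beta> a r \<oplus>\<^bsub>B\<^esub> \<beta> b r"
    and add_r: "\<And>a r s. a \<in> carrier A \<Longrightarrow> r \<in> carrier F \<Longrightarrow> s \<in> carrier F \<Longrightarrow>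
      \<beta> a (r \<oplus>\<^bsub>F\<^esub> s) = \<beta> a r \<oplus>\<^bsub>B\<^esub> \<beta> a s"
    and balanced: "\<And>k a r. k \<in> carrier K \<Longrightarrow> a \<in> carrier A \<Longrightarrow> r \<in> carrier F \<Longrightarrow>
      \<beta> (k \<odot>\<^bsub>A\<^esub> a) r = \<beta> a (k \<otimes>\<^bsub>F\<^esub> r)"
  obtains \<Phi> where "\<And>x. x \<in> carrier M \<Longrightarrow> \<Phi> x \<in> carrier B"
    "\<And>x y. x \<in> carrier M \<Longrightarrow> y \<in> carrier M \<Longrightarrow> \<Phi> (x \<oplus>\<^bsub>M\<^esub> y) = \<Phi> x \<oplus>\<^bsub>B\<^esub> \<Phi> y"
    "\<And>a r. a \<in> carrier A \<Longrightarrow> r \<in> carrier F \<Longrightarrow> \<Phi> (r \<odot>\<^bsub>M\<^esub> incl a) = \<beta> a r"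
proof -
  interpret B: abelian_group B by fact
  have "(\<lambda>(a, r). \<beta> a r) ` (carrier A \<times> carrier F) \<subseteq> carrier (add_monoid B)" using closed by auto
  then obtain h where h: "h \<in> hom free (add_monoid B)"
    "\<And>p. p \<in> carrier A \<times> carrier F \<Longrightarrow> h (frag_of p) = (\<lambda>(a, r). \<beta> a r) p"
    using comm_group.free_Abelian_group_universal[OF B.a_comm_group] unfolding free_def' by blast
  interpret h: group_hom free "add_monoid B" h
    using h(1) by (intro group_hom.intro group_hom_axioms.intro free.is_group B.a_group)
  have hadd: "h (x + y) = h x \<oplus>\<^bsub>B\<^esub> h y" if "x \<in> carrier free" "y \<in> carrier free" for x y
    using h.hom_mult[OF that] by (simp add: free_def')
  have hc: "h x \<in> carrier B" if "x \<in> carrier free" for x using h.hom_closed[OF that] by simp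
  have hdiff: "h (x - y) = \<zero>\<^bsub>B\<^esub>" if "x \<in> carrier free" "y \<in> carrier free" "h x = h y" for x y
    using hadd[of "x - y" y] minus_in_free that hc[of "x - y"] hc[of y] by simp
  have hf: "h (frag_of (a, r)) = \<beta> a r" if "a \<in> carrier A" "r \<in> carrier F" for a r
    using h(2)[of "(a, r)"] that by simp
  have rel: "x \<in> kernel free (add_monoid B) h" if x: "x \<in> tensor_relations K A (self_algebra F)" for x
  proof -
    from x have "h x = \<zero>\<^bsub>B\<^esub>"
    proof (cases rule: tensor_relationE)
      case add_l': add_l
      then show ?thesis by (simp add: hdiff frag_in_free add_in_free hadd hf add_l)
    next
      case add_r': add_r
      then show ?thesis by (simp add: hdiff frag_in_free add_in_free hadd hf add_r)
    next
      case balanced': balanced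
      then show ?thesis by (simp add: hdiff frag_in_free hf balanced K_in_F)
    qed
    then show ?thesis using x relations_in_free by (auto simp: kernel_def)
  qed
  have "kern \<subseteq> kernel free (add_monoid B) h"
    unfolding tensor_kernel_def using rel h.subgroup_kernel
    by (intro free.generate_subgroup_incl) auto
  then obtain g where g: "g \<in> hom (free Mod kern) (add_monoid B)"
    "\<And>x. x \<in> carrier free \<Longrightarrow> g (cls x) = h x"
    using h.FactGroup_universal_kernel[OF normal_kern] unfolding tensor_class_def by blast
  have T_Mod: "carrier T = carrier (free Mod kern)" "add T = monoid.mult (free Mod kern)"
    by (simp_all add: tensor_algebra_def)
  show thesis
  proof (rule that[of "\<lambda>x. g (\<tau> x)"])
    show "g (\<tau> x) \<in> carrier B" if "x \<in> carrier M" for x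
      using hom_in_carrier[OF g(1), of "\<tau> x"] tau_closed[OF that] T_Mod by simp
    show "g (\<tau> (x \<oplus>\<^bsub>M\<^esub> y)) = g (\<tau> x) \<oplus>\<^bsub>B\<^esub> g (\<tau> y)" if "x \<in> carrier M" "y \<in> carrier M" for x y
      using Group.hom_mult[OF g(1), of "\<tau> x" "\<tau> y"] tau_closed that T_Mod by (simp add: tau_hom)
    show "g (\<tau> (r \<odot>\<^bsub>M\<^esub> incl a)) = \<beta> a r" if "a \<in> carrier A" "r \<in> carrier F" for a r
      using that g(2) by (simp flip: tens_eq add: tau_tens frag_in_free hf)
  qed
qed

lemma form_mult_closed:
  assumes R: "subring R F" and "x \<in> form R" "y \<in> form R"
  shows "x \<otimes>\<^bsub>M\<^esub> y \<in> form R"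
proof -
  note RE = subringE[OF R]
  note Mc = form_in_carrier[OF RE(1)]
  have Fc: "r \<in> carrier F" if "r \<in> R" for r using that RE(1) by blast
  have zl: "\<zero>\<^bsub>M\<^esub> \<otimes>\<^bsub>M\<^esub> z = \<zero>\<^bsub>M\<^esub>" and zr: "z \<otimes>\<^bsub>M\<^esub> \<zero>\<^bsub>M\<^esub> = \<zero>\<^bsub>M\<^esub>" if "z \<in> carrier M" for z
    using M.smult_mult_l[of "\<zero>\<^bsub>F\<^esub>" z z] M.smult_mult_r[of "\<zero>\<^bsub>F\<^esub>" z z] that M.mult_closed by auto
  have base: "incl a \<otimes>\<^bsub>M\<^esub> y \<in> form R" if "a \<in> carrier A" "y \<in> form R" for a y
    using that(2)
  proof induction
    case zero then show ?case using that(1) by (simp add: zr lin_span.zero)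
  next
    case (incl g)
    then show ?case using that(1) A.mult_closed by (auto simp: incl_mult[symmetric] intro: lin_span.incl)
  next
    case (add x y)
    then show ?case using that(1) Mc by (simp add: M.mult_r_distr lin_span.add)
  next
    case (smult s x)
    then show ?case using that(1) Mc Fc by (simp add: M.smult_mult_r lin_span.smult)
  qed
  show ?thesis
    using assms(2)
  proof induction
    case zero then show ?case using Mc[OF assms(3)] by (simp add: zl lin_span.zero)
  next
    case (incl g)
    then show ?case using base assms(3) by auto
  next
    case (add x z)
    then show ?case using Mc assms(3) by (simp add: M.mult_l_distr lin_span.add)
  next
    case (smult s x)
    then show ?case using Mc Fc assms(3) by (simp add: M.smult_mult_l lin_span.smult)
  qed
qed

text \<open>
  A map \<open>\<phi>\<close> on scalars that is additive on \<open>F\<close> but multiplicative only on \<open>R\<close> and a homomorphism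
  \<open>j\<close> from \<open>A\<close> to \<open>B\<close> induce a map on \<open>A \<otimes>\<^sub>K F\<close> that is a homomorphism on \<open>A \<otimes>\<^sub>K R\<close>. It is used for
  \<open>\<phi> = id\<close> and \<open>R = F\<close> to extend isomorphisms, and for a specialization \<open>\<phi>\<close> to descend
  them.
\<close>

lemma induced_hom:
  fixes S :: "'u ring" and B :: "('u, 'b) module"
  assumes B: "nonassoc_algebra S B" and R: "subring R F"
    and phi: "\<And>r. r \<in> carrier F \<Longrightarrow> \<phi> r \<in> carrier S"
      "\<And>r s. r \<in> carrier F \<Longrightarrow> s \<in> carrier F \<Longrightarrow> \<phi> (r \<oplus>\<^bsub>F\<^esub> s) = \<phi> r \<oplus>\<^bsub>S\<^esub> \<phi> s"
      "\<phi> \<one>\<^bsub>F\<^esub> = \<one>\<^bsub>S\<^esub>"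
      "\<And>r s. r \<in> R \<Longrightarrow> s \<in> R \<Longrightarrow> \<phi> (r \<otimes>\<^bsub>F\<^esub> s) = \<phi> r \<otimes>\<^bsub>S\<^esub> \<phi> s"
    and j: "\<And>a. a \<in> carrier A \<Longrightarrow> j a \<in> carrier B"
      "\<And>a b. a \<in> carrier A \<Longrightarrow> b \<in> carrier A \<Longrightarrow> j (a \<oplus>\<^bsub>A\<^esub> b) = j a \<oplus>\<^bsub>B\<^esub> j b"
      "\<And>a b. a \<in> carrier A \<Longrightarrow> b \<in> carrier A \<Longrightarrow> j (a \<otimes>\<^bsub>A\<^esub> b) = j a \<otimes>\<^bsub>B\<^esub> j b"
      "\<And>k a r. k \<in> carrier K \<Longrightarrow> a \<in> carrier A \<Longrightarrow> r \<in> carrier F \<Longrightarrow>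
        \<phi> r \<odot>\<^bsub>B\<^esub> j (k \<odot>\<^bsub>A\<^esub> a) = \<phi> (k \<otimes>\<^bsub>F\<^esub> r) \<odot>\<^bsub>B\<^esub> j a"
  obtains \<Phi> where "\<And>x. x \<in> carrier M \<Longrightarrow> \<Phi> x \<in> carrier B"
    "\<And>x y. x \<in> carrier M \<Longrightarrow> y \<in> carrier M \<Longrightarrow> \<Phi> (x \<oplus>\<^bsub>M\<^esub> y) = \<Phi> x \<oplus>\<^bsub>B\<^esub> \<Phi> y"
    "\<And>a. a \<in> carrier A \<Longrightarrow> \<Phi> (incl a) = j a"
    "\<And>r x. r \<in> R \<Longrightarrow> x \<in> form R \<Longrightarrow> \<Phi> (r \<odot>\<^bsub>M\<^esub> x) = \<phi> r \<odot>\<^bsub>B\<^esub> \<Phi> x"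
    "\<And>x y. x \<in> form R \<Longrightarrow> y \<in> form R \<Longrightarrow> \<Phi> (x \<otimes>\<^bsub>M\<^esub> y) = \<Phi> x \<otimes>\<^bsub>B\<^esub> \<Phi> y"
proof -
  interpret B: nonassoc_algebra S B by fact
  note RE = subringE[OF R]
  note Mc = form_in_carrier[OF RE(1)]
  have Fc: "r \<in> carrier F" if "r \<in> R" for r using that RE(1) by blast
  obtain \<Phi> where P: "\<And>x. x \<in> carrier M \<Longrightarrow> \<Phi> x \<in> carrier B"
    "\<And>x y. x \<in> carrier M \<Longrightarrow> y \<in> carrier M \<Longrightarrow> \<Phi> (x \<oplus>\<^bsub>M\<^esub> y) = \<Phi> x \<oplus>\<^bsub>B\<^esub> \<Phi> y"
    "\<And>a r. a \<in> carrier A \<Longrightarrow> r \<in> carrier F \<Longrightarrow> \<Phi> (r \<odot>\<^bsub>M\<^esub> incl a) = \<phi> r \<odot>\<^bsub>B\<^esub> j a"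
  proof (rule universal_property[OF B.abelian_group_axioms, of "\<lambda>a r. \<phi> r \<odot>\<^bsub>B\<^esub> j a"])
  qed (auto simp: phi(1,2) j B.smult_r_distr B.smult_l_distr)
  have P0: "\<Phi> \<zero>\<^bsub>M\<^esub> = \<zero>\<^bsub>B\<^esub>"
    by (rule additive_zero[OF M.abelian_group_axioms B.abelian_group_axioms]) (auto simp: P)
  have Pi: "\<Phi> (incl a) = j a" if "a \<in> carrier A" for a
    using P(3)[of a "\<one>\<^bsub>F\<^esub>"] that by (simp add: phi j)
  have Ps: "\<Phi> (r \<odot>\<^bsub>M\<^esub> x) = \<phi> r \<odot>\<^bsub>B\<^esub> \<Phi> x" if "r \<in> R" "x \<in> form R" for r x
    using that(2,1)
  proof (induction arbitrary: r)
    case zero then show ?case by (simp add: P0 Fc phi)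
  next
    case (incl g) then show ?case by (auto simp: P(3) Pi Fc)
  next
    case (add x y)
    then show ?case by (simp add: M.smult_r_distr Fc Mc P B.smult_r_distr phi)
  next
    case (smult s x)
    have "\<Phi> (r \<odot>\<^bsub>M\<^esub> (s \<odot>\<^bsub>M\<^esub> x)) = \<Phi> ((r \<otimes>\<^bsub>F\<^esub> s) \<odot>\<^bsub>M\<^esub> x)"
      using smult by (simp add: M.smult_assoc1 Fc Mc)
    also have "\<dots> = \<phi> r \<odot>\<^bsub>B\<^esub> (\<phi> s \<odot>\<^bsub>B\<^esub> \<Phi> x)"
      using smult by (simp add: RE(6) phi Fc Mc P B.smult_assoc1)
    also have "\<dots> = \<phi> r \<odot>\<^bsub>B\<^esub> \<Phi> (s \<odot>\<^bsub>M\<^esub> x)" using smult by simp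
    finally show ?case .
  qed
  have zl: "\<zero>\<^bsub>M\<^esub> \<otimes>\<^bsub>M\<^esub> z = \<zero>\<^bsub>M\<^esub>" "z \<otimes>\<^bsub>M\<^esub> \<zero>\<^bsub>M\<^esub> = \<zero>\<^bsub>M\<^esub>" if "z \<in> carrier M" for z
    using M.smult_mult_l[of "\<zero>\<^bsub>F\<^esub>" z z] M.smult_mult_r[of "\<zero>\<^bsub>F\<^esub>" z z] that M.mult_closed by auto
  have zB: "\<zero>\<^bsub>B\<^esub> \<otimes>\<^bsub>B\<^esub> z = \<zero>\<^bsub>B\<^esub>" "z \<otimes>\<^bsub>B\<^esub> \<zero>\<^bsub>B\<^esub> = \<zero>\<^bsub>B\<^esub>" if "z \<in> carrier B" for z
    using B.smult_mult_l[of "\<zero>\<^bsub>S\<^esub>" z z] B.smult_mult_r[of "\<zero>\<^bsub>S\<^esub>" z z] that B.mult_closed by auto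
  have fi: "incl a \<in> form R" if "a \<in> carrier A" for a using that by (auto intro: lin_span.incl)
  have base: "\<Phi> (incl a \<otimes>\<^bsub>M\<^esub> y) = j a \<otimes>\<^bsub>B\<^esub> \<Phi> y" if a: "a \<in> carrier A" and "y \<in> form R" for a y
    using that(2)
  proof induction
    case zero then show ?case using a by (simp add: zl zB P0 j)
  next
    case (incl g) then show ?case using a A.mult_closed by (auto simp: incl_mult[symmetric] Pi j)
  next
    case (add x y)
    then show ?case using a Mc M.mult_closed by (simp add: M.mult_r_distr P B.mult_r_distr j)
  next
    case (smult s x)
    then show ?case using a Mc Fc form_mult_closed[OF R fi[OF a]]
      by (simp add: M.smult_mult_r Ps B.smult_mult_r j P phi)
  qed
  have mult: "\<Phi> (x \<otimes>\<^bsub>M\<^esub> y) = \<Phi> x \<otimes>\<^bsub>B\<^esub> \<Phi> y" if "x \<in> form R" and y: "y \<in> form R" for x y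
    using that(1)
  proof induction
    case zero then show ?case using Mc[OF y] by (simp add: zl zB P0 P)
  next
    case (incl g) then show ?case using y base by (auto simp: Pi)
  next
    case (add x z)
    then show ?case using y Mc M.mult_closed by (simp add: M.mult_l_distr P B.mult_l_distr)
  next
    case (smult s x)
    then show ?case using y Mc Fc form_mult_closed[OF R _ y]
      by (simp add: M.smult_mult_l Ps B.smult_mult_l P phi)
  qed
  show thesis by (rule that[OF P(1,2) Pi Ps mult])
qed

end

section \<open>Isomorphisms of algebras\<close>

lemma nalg_isomorphicI:
  assumes "\<And>x. x \<in> carrier A \<Longrightarrow> f x \<in> carrier B" "\<And>y. y \<in> carrier B \<Longrightarrow> g y \<in> carrier A"
    and "\<And>x. x \<in> carrier A \<Longrightarrow> g (f x) = x" "\<And>y. y \<in> carrier B \<Longrightarrow> f (g y) = y"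
    and A: "nonassoc_algebra R A"
    and hom: "\<And>x y. x \<in> carrier A \<Longrightarrow> y \<in> carrier A \<Longrightarrow> f (x \<oplus>\<^bsub>A\<^esub> y) = f x \<oplus>\<^bsub>B\<^esub> f y"
    "\<And>x y. x \<in> carrier A \<Longrightarrow> y \<in> carrier A \<Longrightarrow> f (x \<otimes>\<^bsub>A\<^esub> y) = f x \<otimes>\<^bsub>B\<^esub> f y"
    "\<And>k x. k \<in> carrier R \<Longrightarrow> x \<in> carrier A \<Longrightarrow> f (k \<odot>\<^bsub>A\<^esub> x) = k \<odot>\<^bsub>B\<^esub> f x"
  shows "nalg_isomorphic R A B"
proof -
  interpret A: nonassoc_algebra R A by fact
  have "bij_betw f (carrier A) (carrier B)"
    by (rule bij_betw_byWitness[of _ g]) (use assms in auto)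
  then have "bij_betw (restrict f (carrier A)) (carrier A) (carrier B)"
    using bij_betw_cong[of "carrier A" "restrict f (carrier A)" f "carrier B"] by simp
  then have "restrict f (carrier A) \<in> nalg_iso R A B"
    using assms(1) hom by (auto simp: nalg_iso_def nalg_hom_def A.mult_closed)
  then show ?thesis by (auto simp: nalg_isomorphic_def)
qed

lemma nalg_isomorphicE:
  assumes "nalg_isomorphic R A B"
  obtains f g where "\<And>x. x \<in> carrier A \<Longrightarrow> f x \<in> carrier B" "\<And>y. y \<in> carrier B \<Longrightarrow> g y \<in> carrier A"
    "\<And>x. x \<in> carrier A \<Longrightarrow> g (f x) = x" "\<And>y. y \<in> carrier B \<Longrightarrow> f (g y) = y"
    "\<And>x y. x \<in> carrier A \<Longrightarrow> y \<in> carrier A \<Longrightarrow> f (x \<oplus>\<^bsub>A\<^esub> y) = f x \<oplus>\<^bsub>B\<^esub> f y"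
    "\<And>x y. x \<in> carrier A \<Longrightarrow> y \<in> carrier A \<Longrightarrow> f (x \<otimes>\<^bsub>A\<^esub> y) = f x \<otimes>\<^bsub>B\<^esub> f y"
    "\<And>k x. k \<in> carrier R \<Longrightarrow> x \<in> carrier A \<Longrightarrow> f (k \<odot>\<^bsub>A\<^esub> x) = k \<odot>\<^bsub>B\<^esub> f x"
proof -
  obtain f where "f \<in> nalg_iso R A B" using assms by (auto simp: nalg_isomorphic_def)
  then show thesis
    by (intro that[of f "inv_into (carrier A) f"])
       (auto simp: nalg_iso_def nalg_hom_def bij_betw_def inv_into_into f_inv_into_f)
qed

section \<open>Extending and descending isomorphisms\<close>

locale two_extensions =
  E: scalar_extension F K A M \<tau> + E': scalar_extension F K A' M' \<tau>'
  for F K :: "'u ring" and A :: "('u, 'v) module" and M :: "('u, 'm) module" and \<tau>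
    and A' :: "('u, 'w) module" and M' :: "('u, 'n) module" and \<tau>'
begin

lemma extend_iso:
  assumes f: "\<And>x. x \<in> carrier A \<Longrightarrow> f x \<in> carrier A'"
    "\<And>x y. x \<in> carrier A \<Longrightarrow> y \<in> carrier A \<Longrightarrow> f (x \<oplus>\<^bsub>A\<^esub> y) = f x \<oplus>\<^bsub>A'\<^esub> f y"
    "\<And>x y. x \<in> carrier A \<Longrightarrow> y \<in> carrier A \<Longrightarrow> f (x \<otimes>\<^bsub>A\<^esub> y) = f x \<otimes>\<^bsub>A'\<^esub> f y"
    "\<And>k x. k \<in> carrier K \<Longrightarrow> x \<in> carrier A \<Longrightarrow> f (k \<odot>\<^bsub>A\<^esub> x) = k \<odot>\<^bsub>A'\<^esub> f x"
  obtains \<Phi> where "\<And>x. x \<in> carrier M \<Longrightarrow> \<Phi> x \<in> carrier M'"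
    "\<And>x y. x \<in> carrier M \<Longrightarrow> y \<in> carrier M \<Longrightarrow> \<Phi> (x \<oplus>\<^bsub>M\<^esub> y) = \<Phi> x \<oplus>\<^bsub>M'\<^esub> \<Phi> y"
    "\<And>x y. x \<in> carrier M \<Longrightarrow> y \<in> carrier M \<Longrightarrow> \<Phi> (x \<otimes>\<^bsub>M\<^esub> y) = \<Phi> x \<otimes>\<^bsub>M'\<^esub> \<Phi> y"
    "\<And>k x. k \<in> carrier F \<Longrightarrow> x \<in> carrier M \<Longrightarrow> \<Phi> (k \<odot>\<^bsub>M\<^esub> x) = k \<odot>\<^bsub>M'\<^esub> \<Phi> x"
    "\<And>a. a \<in> carrier A \<Longrightarrow> \<Phi> (E.incl a) = E'.incl (f a)"
proof -
  obtain \<Phi> where P: "\<And>x. x \<in> carrier M \<Longrightarrow> \<Phi> x \<in> carrier M'"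
    "\<And>x y. x \<in> carrier M \<Longrightarrow> y \<in> carrier M \<Longrightarrow> \<Phi> (x \<oplus>\<^bsub>M\<^esub> y) = \<Phi> x \<oplus>\<^bsub>M'\<^esub> \<Phi> y"
    "\<And>a. a \<in> carrier A \<Longrightarrow> \<Phi> (E.incl a) = E'.incl (f a)"
    "\<And>r x. r \<in> carrier F \<Longrightarrow> x \<in> E.form (carrier F) \<Longrightarrow> \<Phi> (r \<odot>\<^bsub>M\<^esub> x) = r \<odot>\<^bsub>M'\<^esub> \<Phi> x"
    "\<And>x y. x \<in> E.form (carrier F) \<Longrightarrow> y \<in> E.form (carrier F) \<Longrightarrow> \<Phi> (x \<otimes>\<^bsub>M\<^esub> y) = \<Phi> x \<otimes>\<^bsub>M'\<^esub> \<Phi> y"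
  proof (rule E.induced_hom[OF E'.M_algebra E.F.carrier_is_subring, of "\<lambda>r. r" "\<lambda>a. E'.incl (f a)"])
    show "r \<odot>\<^bsub>M'\<^esub> E'.incl (f (k \<odot>\<^bsub>A\<^esub> a)) = (k \<otimes>\<^bsub>F\<^esub> r) \<odot>\<^bsub>M'\<^esub> E'.incl (f a)"
      if "k \<in> carrier K" "a \<in> carrier A" "r \<in> carrier F" for k a r
      using that f E.K_in_F[of k] E.F.m_comm[of k r]
      by (simp add: E'.incl_smult E'.M.smult_assoc1)
  qed (auto simp: f E'.incl_add E'.incl_mult)
  show thesis by (rule that[OF P(1,2)]) (use P E.form_carrier in auto)
qed

lemma iso_extends:
  assumes "nalg_isomorphic K A A'"
  shows "nalg_isomorphic F M M'"
proof -
  obtain f g where fg: "\<And>x. x \<in> carrier A \<Longrightarrow> f x \<in> carrier A'" "\<And>y. y \<in> carrier A' \<Longrightarrow> g y \<in> carrier A"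
    "\<And>x. x \<in> carrier A \<Longrightarrow> g (f x) = x" "\<And>y. y \<in> carrier A' \<Longrightarrow> f (g y) = y"
    and f: "\<And>x y. x \<in> carrier A \<Longrightarrow> y \<in> carrier A \<Longrightarrow> f (x \<oplus>\<^bsub>A\<^esub> y) = f x \<oplus>\<^bsub>A'\<^esub> f y"
    "\<And>x y. x \<in> carrier A \<Longrightarrow> y \<in> carrier A \<Longrightarrow> f (x \<otimes>\<^bsub>A\<^esub> y) = f x \<otimes>\<^bsub>A'\<^esub> f y"
    "\<And>k x. k \<in> carrier K \<Longrightarrow> x \<in> carrier A \<Longrightarrow> f (k \<odot>\<^bsub>A\<^esub> x) = k \<odot>\<^bsub>A'\<^esub> f x"
    using nalg_isomorphicE[OF assms] by blast
  obtain \<Phi> where P: "\<And>x. x \<in> carrier M \<Longrightarrow> \<Phi> x \<in> carrier M'"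
    "\<And>x y. x \<in> carrier M \<Longrightarrow> y \<in> carrier M \<Longrightarrow> \<Phi> (x \<oplus>\<^bsub>M\<^esub> y) = \<Phi> x \<oplus>\<^bsub>M'\<^esub> \<Phi> y"
    "\<And>x y. x \<in> carrier M \<Longrightarrow> y \<in> carrier M \<Longrightarrow> \<Phi> (x \<otimes>\<^bsub>M\<^esub> y) = \<Phi> x \<otimes>\<^bsub>M'\<^esub> \<Phi> y"
    "\<And>k x. k \<in> carrier F \<Longrightarrow> x \<in> carrier M \<Longrightarrow> \<Phi> (k \<odot>\<^bsub>M\<^esub> x) = k \<odot>\<^bsub>M'\<^esub> \<Phi> x"
    "\<And>a. a \<in> carrier A \<Longrightarrow> \<Phi> (E.incl a) = E'.incl (f a)"
    using extend_iso[of f] fg f by blast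
  interpret rev: two_extensions F K A' M' \<tau>' A M \<tau> ..
  have g: "g (x \<oplus>\<^bsub>A'\<^esub> y) = g x \<oplus>\<^bsub>A\<^esub> g y" "g (x \<otimes>\<^bsub>A'\<^esub> y) = g x \<otimes>\<^bsub>A\<^esub> g y"
    if "x \<in> carrier A'" "y \<in> carrier A'" for x y
    using fg(3)[of "g x \<oplus>\<^bsub>A\<^esub> g y"] fg(3)[of "g x \<otimes>\<^bsub>A\<^esub> g y"] that
    by (simp_all add: fg(1,2,4) f E.A.mult_closed)
  have g3: "g (k \<odot>\<^bsub>A'\<^esub> x) = k \<odot>\<^bsub>A\<^esub> g x" if "k \<in> carrier K" "x \<in> carrier A'" for k x
    using fg(3)[of "k \<odot>\<^bsub>A\<^esub> g x"] that by (simp add: fg(1,2,4) f)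
  obtain \<Psi> where Q: "\<And>x. x \<in> carrier M' \<Longrightarrow> \<Psi> x \<in> carrier M"
    "\<And>x y. x \<in> carrier M' \<Longrightarrow> y \<in> carrier M' \<Longrightarrow> \<Psi> (x \<oplus>\<^bsub>M'\<^esub> y) = \<Psi> x \<oplus>\<^bsub>M\<^esub> \<Psi> y"
    "\<And>x y. x \<in> carrier M' \<Longrightarrow> y \<in> carrier M' \<Longrightarrow> \<Psi> (x \<otimes>\<^bsub>M'\<^esub> y) = \<Psi> x \<otimes>\<^bsub>M\<^esub> \<Psi> y"
    "\<And>k x. k \<in> carrier F \<Longrightarrow> x \<in> carrier M' \<Longrightarrow> \<Psi> (k \<odot>\<^bsub>M'\<^esub> x) = k \<odot>\<^bsub>M\<^esub> \<Psi> x"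
    "\<And>a. a \<in> carrier A' \<Longrightarrow> \<Psi> (E'.incl a) = E.incl (g a)"
    using rev.extend_iso[of g] fg g g3 by blast
  have P0: "\<Phi> \<zero>\<^bsub>M\<^esub> = \<zero>\<^bsub>M'\<^esub>"
    by (rule additive_zero[OF E.M.abelian_group_axioms E'.M.abelian_group_axioms]) (auto simp: P)
  have Q0: "\<Psi> \<zero>\<^bsub>M'\<^esub> = \<zero>\<^bsub>M\<^esub>"
    by (rule additive_zero[OF E'.M.abelian_group_axioms E.M.abelian_group_axioms]) (auto simp: Q)
  have "\<Psi> (\<Phi> x) = x" if "x \<in> E.form (carrier F)" for x
    using that
    by induction (auto simp: P0 Q0 P Q fg E.form_carrier)
  moreover have "\<Phi> (\<Psi> x) = x" if "x \<in> E'.form (carrier F)" for x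
    using that
    by induction (auto simp: P0 Q0 P Q fg E'.form_carrier)
  ultimately show ?thesis
    using P Q E.form_carrier E'.form_carrier
    by (intro nalg_isomorphicI[of M \<Phi> M' \<Psi>]) (auto intro: E.M_algebra)
qed

text \<open>
  The set \<open>G\<close> consists of the coefficients of the images of a spanning set of \<open>A\<close>, finitely many for
  each. If the spanning set is infinite, \<open>G\<close> is no larger than it.
\<close>

lemma linear_map_few_scalars:
  assumes f: "\<And>x. x \<in> carrier M \<Longrightarrow> f x \<in> carrier M'"
    "\<And>x y. x \<in> carrier M \<Longrightarrow> y \<in> carrier M \<Longrightarrow> f (x \<oplus>\<^bsub>M\<^esub> y) = f x \<oplus>\<^bsub>M'\<^esub> f y"
    "\<And>k x. k \<in> carrier F \<Longrightarrow> x \<in> carrier M \<Longrightarrow> f (k \<odot>\<^bsub>M\<^esub> x) = k \<odot>\<^bsub>M'\<^esub> f x"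
    and dim: "vdim K A <o |carrier K|"
  obtains G where "G \<subseteq> carrier F" "finite G \<or> |G| <o |carrier K| \<and> infinite (carrier K)"
    "\<And>R x. carrier K \<union> G \<subseteq> R \<Longrightarrow> R \<subseteq> carrier F \<Longrightarrow> x \<in> E.form R \<Longrightarrow> f x \<in> E'.form R"
proof -
  have "field K" using E.F.subfield_iff(2)[OF E.K_subfield] E.K_eq by simp
  then obtain B where B: "B \<subseteq> carrier A" "lin_span (carrier K) A B = carrier A" "vdim K A = |B|"
    using E.A.vdim_spanning_set by blast
  have "\<exists>U. finite U \<and> U \<subseteq> carrier F \<and> f (E.incl b) \<in> E'.form U" if "b \<in> B" for b
  proof (rule lin_span_finite_scalars)
    show "f (E.incl b) \<in> E'.form (carrier F)" using E'.form_carrier f(1) B(1) that by auto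
  qed
  then obtain U where U: "\<And>b. b \<in> B \<Longrightarrow> finite (U b)" "\<And>b. b \<in> B \<Longrightarrow> U b \<subseteq> carrier F"
    "\<And>b. b \<in> B \<Longrightarrow> f (E.incl b) \<in> E'.form (U b)"
    by metis
  define G where "G = (\<Union>b\<in>B. U b)"
  show thesis
  proof (rule that[of G])
    show "G \<subseteq> carrier F" using U(2) by (auto simp: G_def)
    show "finite G \<or> |G| <o |carrier K| \<and> infinite (carrier K)"
    proof (cases "finite B")
      case True
      then show ?thesis using U(1) by (simp add: G_def)
    next
      case False
      have "|G| \<le>o |B|"
        unfolding G_def
      proof (rule card_of_UNION_ordLeq_infinite[OF False])
        show "\<forall>b\<in>B. |U b| \<le>o |B|"
          using False U(1) finite_ordLess_infinite2 ordLess_imp_ordLeq by blast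
      qed simp
      moreover have less: "|B| <o |carrier K|" using dim B(3) by simp
      moreover have "infinite (carrier K)"
        using False less ordLess_imp_ordLeq card_of_ordLeq_infinite by blast
      ultimately show ?thesis using ordLeq_ordLess_trans by blast
    qed
    fix R x assume R: "carrier K \<union> G \<subseteq> R" "R \<subseteq> carrier F" and x: "x \<in> E.form R"
    have f0: "f \<zero>\<^bsub>M\<^esub> = \<zero>\<^bsub>M'\<^esub>"
      by (rule additive_zero[OF E.M.abelian_group_axioms E'.M.abelian_group_axioms]) (auto simp: f)
    have "f (E.incl a) \<in> E'.form R" if "a \<in> lin_span (carrier K) A B" for a
      using that
    proof induction
      case zero then show ?case by (simp add: E.incl_zero f0 lin_span.zero)
    next
      case (incl b)
      moreover have "U b \<subseteq> R" using incl R by (auto simp: G_def)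
      ultimately show ?case using U(3)[of b] lin_span_mono[of "U b" R M' "E'.incl ` carrier A'"] by blast
    next
      case (add a b)
      then show ?case by (simp add: B(2) E.incl_add f lin_span.add)
    next
      case (smult k a)
      then have "k \<in> R" using R by auto
      then show ?case using smult by (simp add: B(2) E.incl_smult f E.K_in_F lin_span.smult)
    qed
    then have base: "f (E.incl a) \<in> E'.form R" if "a \<in> carrier A" for a using that B(2) by simp
    show "f x \<in> E'.form R"
      using x
    proof induction
      case zero then show ?case by (simp add: f0 lin_span.zero)
    next
      case (incl g) then show ?case using base by auto
    next
      case (add x y)
      then show ?case using E.form_in_carrier[OF R(2)] by (simp add: f lin_span.add)
    next
      case (smult s x)
      then show ?case using E.form_in_carrier[OF R(2)] R(2) by (simp add: f lin_span.smult subset_iff)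
    qed
  qed
qed

text \<open>
  Specializing before or after the application of \<open>f\<close> gives the same result: on \<open>A \<otimes>\<^sub>K R\<close>
  both sides are \<open>\<phi>\<close>-semilinear in \<open>x\<close>, and they agree on \<open>A\<close>, where \<open>\<Phi>\<close> is the identity. Therefore the composite of
  two specialized maps is the specialization of the composite.
\<close>

lemma specialization_of_composite:
  assumes R: "subring R F" "carrier K \<subseteq> R"
    and phi: "\<And>r. r \<in> carrier F \<Longrightarrow> \<phi> r \<in> carrier K" "\<And>k. k \<in> carrier K \<Longrightarrow> \<phi> k = k"
    and f: "\<And>x y. x \<in> carrier M \<Longrightarrow> y \<in> carrier M \<Longrightarrow> f (x \<oplus>\<^bsub>M\<^esub> y) = f x \<oplus>\<^bsub>M'\<^esub> f y"
      "\<And>x. x \<in> carrier M \<Longrightarrow> f x \<in> carrier M'"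
      "\<And>k x. k \<in> carrier F \<Longrightarrow> x \<in> carrier M \<Longrightarrow> f (k \<odot>\<^bsub>M\<^esub> x) = k \<odot>\<^bsub>M'\<^esub> f x"
      "\<And>x. x \<in> E.form R \<Longrightarrow> f x \<in> E'.form R"
    and P: "\<And>x. x \<in> carrier M \<Longrightarrow> \<Phi> x \<in> carrier A"
      "\<And>x y. x \<in> carrier M \<Longrightarrow> y \<in> carrier M \<Longrightarrow> \<Phi> (x \<oplus>\<^bsub>M\<^esub> y) = \<Phi> x \<oplus>\<^bsub>A\<^esub> \<Phi> y"
      "\<And>a. a \<in> carrier A \<Longrightarrow> \<Phi> (E.incl a) = a"
      "\<And>r x. r \<in> R \<Longrightarrow> x \<in> E.form R \<Longrightarrow> \<Phi> (r \<odot>\<^bsub>M\<^esub> x) = \<phi> r \<odot>\<^bsub>A\<^esub> \<Phi> x"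
    and Q: "\<And>x. x \<in> carrier M' \<Longrightarrow> \<Psi> x \<in> carrier A'"
      "\<And>x y. x \<in> carrier M' \<Longrightarrow> y \<in> carrier M' \<Longrightarrow> \<Psi> (x \<oplus>\<^bsub>M'\<^esub> y) = \<Psi> x \<oplus>\<^bsub>A'\<^esub> \<Psi> y"
      "\<And>r x. r \<in> R \<Longrightarrow> x \<in> E'.form R \<Longrightarrow> \<Psi> (r \<odot>\<^bsub>M'\<^esub> x) = \<phi> r \<odot>\<^bsub>A'\<^esub> \<Psi> x"
    and x: "x \<in> E.form R"
  shows "\<Psi> (f (E.incl (\<Phi> x))) = \<Psi> (f x)"
  using x
proof induction
  note RF = subringE(1)[OF R(1)]
  note Mc = E.form_in_carrier[OF RF]
  have P0: "\<Phi> \<zero>\<^bsub>M\<^esub> = \<zero>\<^bsub>A\<^esub>"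
    by (rule additive_zero[OF E.M.abelian_group_axioms E.A.abelian_group_axioms]) (auto simp: P)
  have fi: "E.incl a \<in> E.form R" if "a \<in> carrier A" for a using that by (auto intro: lin_span.incl)
  {
    case zero then show ?case by (simp add: P0 E.incl_zero)
  next
    case (incl g) then show ?case by (auto simp: P)
  next
    case (add x y) then show ?case by (simp add: Mc P E.incl_add f Q)
  next
    case (smult s x)
    have s: "\<phi> s \<in> carrier K" "\<phi> s \<in> R" "s \<in> carrier F" "\<phi> s \<in> carrier F"
      using phi(1)[of s] subsetD[OF RF smult(1)] subsetD[OF R(2), of "\<phi> s"] subsetD[OF RF, of "\<phi> s"] by auto
    have c: "\<Phi> x \<in> carrier A" "x \<in> carrier M" using smult Mc P by auto
    have "\<Psi> (f (E.incl (\<Phi> (s \<odot>\<^bsub>M\<^esub> x)))) = \<Psi> (\<phi> s \<odot>\<^bsub>M'\<^esub> f (E.incl (\<Phi> x)))"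
      using smult s c by (simp add: P E.incl_smult f)
    also have "\<dots> = \<phi> s \<odot>\<^bsub>A'\<^esub> \<Psi> (f (E.incl (\<Phi> x)))"
      using Q(3)[OF s(2) f(4)[OF fi[OF c(1)]]] phi(2)[OF s(1)] by simp
    also have "\<dots> = \<Psi> (s \<odot>\<^bsub>M'\<^esub> f x)" using smult Q(3) f(4) by simp
    also have "\<dots> = \<Psi> (f (s \<odot>\<^bsub>M\<^esub> x))" using s c f by simp
    finally show ?case .
  }
qed

text \<open>
  The coefficients of an isomorphism \<open>f\<close> and of its inverse \<open>g\<close> generate, together with \<open>K\<close>, a subring \<open>R\<close> that has a specialization
  \<open>\<phi>\<close> to \<open>K\<close>. If \<open>\<Phi>\<close> and \<open>\<Psi>\<close> denote the induced maps from the two tensor products to \<open>A\<close> and \<open>A'\<close>,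
  then \<open>a \<mapsto> \<Psi> (f (a \<otimes> 1))\<close> and \<open>b \<mapsto> \<Phi> (g (b \<otimes> 1))\<close> are the required mutually inverse
  homomorphisms.
\<close>

theorem iso_descends:
  assumes closed: "algebraically_closed K"
    and dim: "vdim K A <o |carrier K|" "vdim K A' <o |carrier K|"
    and iso: "nalg_isomorphic F M M'"
  shows "nalg_isomorphic K A A'"
proof -
  obtain f g where fg: "\<And>x. x \<in> carrier M \<Longrightarrow> f x \<in> carrier M'" "\<And>y. y \<in> carrier M' \<Longrightarrow> g y \<in> carrier M"
    "\<And>x. x \<in> carrier M \<Longrightarrow> g (f x) = x" "\<And>y. y \<in> carrier M' \<Longrightarrow> f (g y) = y"
    and f: "\<And>x y. x \<in> carrier M \<Longrightarrow> y \<in> carrier M \<Longrightarrow> f (x \<oplus>\<^bsub>M\<^esub> y) = f x \<oplus>\<^bsub>M'\<^esub> f y"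
    "\<And>x y. x \<in> carrier M \<Longrightarrow> y \<in> carrier M \<Longrightarrow> f (x \<otimes>\<^bsub>M\<^esub> y) = f x \<otimes>\<^bsub>M'\<^esub> f y"
    "\<And>k x. k \<in> carrier F \<Longrightarrow> x \<in> carrier M \<Longrightarrow> f (k \<odot>\<^bsub>M\<^esub> x) = k \<odot>\<^bsub>M'\<^esub> f x"
    using nalg_isomorphicE[OF iso] by blast
  interpret rev: two_extensions F K A' M' \<tau>' A M \<tau> ..
  have g: "g (x \<oplus>\<^bsub>M'\<^esub> y) = g x \<oplus>\<^bsub>M\<^esub> g y"
    if "x \<in> carrier M'" "y \<in> carrier M'" for x y
    using fg(3)[of "g x \<oplus>\<^bsub>M\<^esub> g y"] that by (simp add: fg(1,2,4) f)
  have g3: "g (k \<odot>\<^bsub>M'\<^esub> x) = k \<odot>\<^bsub>M\<^esub> g x" if "k \<in> carrier F" "x \<in> carrier M'" for k x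
    using fg(3)[of "k \<odot>\<^bsub>M\<^esub> g x"] that by (simp add: fg(1,2,4) f)
  obtain G1 where G1: "G1 \<subseteq> carrier F" "finite G1 \<or> |G1| <o |carrier K| \<and> infinite (carrier K)"
    "\<And>R x. carrier K \<union> G1 \<subseteq> R \<Longrightarrow> R \<subseteq> carrier F \<Longrightarrow> x \<in> E.form R \<Longrightarrow> f x \<in> E'.form R"
    using linear_map_few_scalars[of f, OF fg(1) f(1,3) dim(1)] by blast
  obtain G2 where G2: "G2 \<subseteq> carrier F" "finite G2 \<or> |G2| <o |carrier K| \<and> infinite (carrier K)"
    "\<And>R x. carrier K \<union> G2 \<subseteq> R \<Longrightarrow> R \<subseteq> carrier F \<Longrightarrow> x \<in> E'.form R \<Longrightarrow> g x \<in> E.form R"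
    using rev.linear_map_few_scalars[of g, OF fg(2) g g3 dim(2)] by blast
  define G where "G = G1 \<union> G2"
  have GF: "G \<subseteq> carrier F" using G1 G2 by (simp add: G_def)
  have Gcard: "finite G \<or> |G| <o |carrier K|"
  proof (cases "finite G")
    case False
    then have inf: "infinite (carrier K)" using G1(2) G2(2) by (auto simp: G_def)
    have "|G1| <o |carrier K|" "|G2| <o |carrier K|"
      using G1(2) G2(2) inf finite_ordLess_infinite2 by blast+
    then show ?thesis unfolding G_def using card_of_Un_ordLess_infinite[OF inf] by blast
  qed simp
  define R where "R = generate_ring F (carrier K \<union> G)"
  have KF: "carrier K \<subseteq> carrier F" using E.K_in_F by blast
  have R: "subring R F" unfolding R_def using KF GF by (intro E.F.generate_ring_is_subring) auto
  note RF = subringE(1)[OF R]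
  have KR: "carrier K \<union> G1 \<subseteq> R" "carrier K \<union> G2 \<subseteq> R" "carrier K \<subseteq> R"
    by (auto simp: R_def G_def intro: generate_ring.incl)
  have closed': "algebraically_closed (F\<lparr>carrier := carrier K\<rparr>)"
    by (subst E.K_eq[symmetric]) (rule closed)
  obtain \<phi> where phi: "\<And>x. x \<in> carrier F \<Longrightarrow> \<phi> x \<in> carrier K"
    "\<And>x y. x \<in> carrier F \<Longrightarrow> y \<in> carrier F \<Longrightarrow> \<phi> (x \<oplus>\<^bsub>F\<^esub> y) = \<phi> x \<oplus>\<^bsub>F\<^esub> \<phi> y"
    "\<And>c x. c \<in> carrier K \<Longrightarrow> x \<in> carrier F \<Longrightarrow> \<phi> (c \<otimes>\<^bsub>F\<^esub> x) = c \<otimes>\<^bsub>F\<^esub> \<phi> x"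
    "\<phi> \<one>\<^bsub>F\<^esub> = \<one>\<^bsub>F\<^esub>"
    "\<And>x y. x \<in> R \<Longrightarrow> y \<in> R \<Longrightarrow> \<phi> (x \<otimes>\<^bsub>F\<^esub> y) = \<phi> x \<otimes>\<^bsub>F\<^esub> \<phi> y"
    using exists_specialization[OF E.F_field E.K_subfield closed' GF Gcard] unfolding R_def by blast
  have phik: "\<phi> k = k" if "k \<in> carrier K" for k
    using phi(3)[of k "\<one>\<^bsub>F\<^esub>"] phi(4) that E.K_in_F by simp
  obtain \<Phi> where P: "\<And>x. x \<in> carrier M \<Longrightarrow> \<Phi> x \<in> carrier A"
    "\<And>x y. x \<in> carrier M \<Longrightarrow> y \<in> carrier M \<Longrightarrow> \<Phi> (x \<oplus>\<^bsub>M\<^esub> y) = \<Phi> x \<oplus>\<^bsub>A\<^esub> \<Phi> y"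
    "\<And>a. a \<in> carrier A \<Longrightarrow> \<Phi> (E.incl a) = a"
    "\<And>r x. r \<in> R \<Longrightarrow> x \<in> E.form R \<Longrightarrow> \<Phi> (r \<odot>\<^bsub>M\<^esub> x) = \<phi> r \<odot>\<^bsub>A\<^esub> \<Phi> x"
    "\<And>x y. x \<in> E.form R \<Longrightarrow> y \<in> E.form R \<Longrightarrow> \<Phi> (x \<otimes>\<^bsub>M\<^esub> y) = \<Phi> x \<otimes>\<^bsub>A\<^esub> \<Phi> y"
  proof (rule E.induced_hom[OF E.A_algebra R, of \<phi> "\<lambda>a. a"])
    show "\<phi> r \<odot>\<^bsub>A\<^esub> (k \<odot>\<^bsub>A\<^esub> a) = \<phi> (k \<otimes>\<^bsub>F\<^esub> r) \<odot>\<^bsub>A\<^esub> a"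
      if "k \<in> carrier K" "a \<in> carrier A" "r \<in> carrier F" for k a r
      using that phi(1,3) E.A.smult_assoc1[of "\<phi> r" k a] E.A.R.m_comm[of k "\<phi> r"] by simp
  qed (auto simp: phi)
  obtain \<Psi> where Q: "\<And>x. x \<in> carrier M' \<Longrightarrow> \<Psi> x \<in> carrier A'"
    "\<And>x y. x \<in> carrier M' \<Longrightarrow> y \<in> carrier M' \<Longrightarrow> \<Psi> (x \<oplus>\<^bsub>M'\<^esub> y) = \<Psi> x \<oplus>\<^bsub>A'\<^esub> \<Psi> y"
    "\<And>a. a \<in> carrier A' \<Longrightarrow> \<Psi> (E'.incl a) = a"
    "\<And>r x. r \<in> R \<Longrightarrow> x \<in> E'.form R \<Longrightarrow> \<Psi> (r \<odot>\<^bsub>M'\<^esub> x) = \<phi> r \<odot>\<^bsub>A'\<^esub> \<Psi> x"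
    "\<And>x y. x \<in> E'.form R \<Longrightarrow> y \<in> E'.form R \<Longrightarrow> \<Psi> (x \<otimes>\<^bsub>M'\<^esub> y) = \<Psi> x \<otimes>\<^bsub>A'\<^esub> \<Psi> y"
  proof (rule E'.induced_hom[OF E'.A_algebra R, of \<phi> "\<lambda>a. a"])
    show "\<phi> r \<odot>\<^bsub>A'\<^esub> (k \<odot>\<^bsub>A'\<^esub> a) = \<phi> (k \<otimes>\<^bsub>F\<^esub> r) \<odot>\<^bsub>A'\<^esub> a"
      if "k \<in> carrier K" "a \<in> carrier A'" "r \<in> carrier F" for k a r
      using that phi(1,3) E'.A.smult_assoc1[of "\<phi> r" k a] E.A.R.m_comm[of k "\<phi> r"] by simp
  qed (auto simp: phi)
  have fR: "f x \<in> E'.form R" if "x \<in> E.form R" for x using G1(3)[OF KR(1) RF that] .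
  have gR: "g x \<in> E.form R" if "x \<in> E'.form R" for x using G2(3)[OF KR(2) RF that] .
  have iR: "E.incl a \<in> E.form R" if "a \<in> carrier A" for a using that by (auto intro: lin_span.incl)
  have iR': "E'.incl a \<in> E'.form R" if "a \<in> carrier A'" for a using that by (auto intro: lin_span.incl)
  show ?thesis
  proof (rule nalg_isomorphicI[of A "\<lambda>a. \<Psi> (f (E.incl a))" A' "\<lambda>b. \<Phi> (g (E'.incl b))"])
    show "\<Psi> (f (E.incl a)) \<in> carrier A'" if "a \<in> carrier A" for a using that by (simp add: Q fg)
    show "\<Phi> (g (E'.incl b)) \<in> carrier A" if "b \<in> carrier A'" for b using that by (simp add: P fg)
    show "\<Phi> (g (E'.incl (\<Psi> (f (E.incl a))))) = a" if "a \<in> carrier A" for a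
      using rev.specialization_of_composite[of R \<phi> g \<Psi> \<Phi> "f (E.incl a)", OF R KR(3) phi(1) phik g fg(2) g3 gR Q(1,2,3,4) P(1,2,4)]
        that iR fR by (simp add: fg P)
    show "\<Psi> (f (E.incl (\<Phi> (g (E'.incl b))))) = b" if "b \<in> carrier A'" for b
      using specialization_of_composite[of R \<phi> f \<Phi> \<Psi> "g (E'.incl b)", OF R KR(3) phi(1) phik f(1) fg(1) f(3) fR P(1,2,3,4) Q(1,2,4)]
        that iR' gR by (simp add: fg Q)
    show "\<Psi> (f (E.incl (a \<oplus>\<^bsub>A\<^esub> b))) = \<Psi> (f (E.incl a)) \<oplus>\<^bsub>A'\<^esub> \<Psi> (f (E.incl b))"
      if "a \<in> carrier A" "b \<in> carrier A" for a b using that by (simp add: E.incl_add f fg Q)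
    show "\<Psi> (f (E.incl (a \<otimes>\<^bsub>A\<^esub> b))) = \<Psi> (f (E.incl a)) \<otimes>\<^bsub>A'\<^esub> \<Psi> (f (E.incl b))"
      if "a \<in> carrier A" "b \<in> carrier A" for a b using that by (simp add: E.incl_mult f fg Q iR fR)
    show "\<Psi> (f (E.incl (k \<odot>\<^bsub>A\<^esub> a))) = k \<odot>\<^bsub>A'\<^esub> \<Psi> (f (E.incl a))"
      if "k \<in> carrier K" "a \<in> carrier A" for k a
    proof -
      have "k \<in> R" using KR(3) that by auto
      then show ?thesis using that by (simp add: E.incl_smult E.K_in_F f fg Q iR fR phik)
    qed
  qed (rule E.A_algebra)
qed

end

section \<open>The equivalence for extension invariant functors\<close>

theorem theorem5p6:
  fixes F K :: "'u ring"
    and Fo :: "('u, 'u) module \<Rightarrow> ('u, 'v) module"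
    and Fm :: "('u, 'u) module \<Rightarrow> ('u, 'u) module \<Rightarrow> ('u \<Rightarrow> 'u) \<Rightarrow> ('v \<Rightarrow> 'v)"
    and Go :: "('u, 'u) module \<Rightarrow> ('u, 'w) module"
    and Gm :: "('u, 'u) module \<Rightarrow> ('u, 'u) module \<Rightarrow> ('u \<Rightarrow> 'u) \<Rightarrow> ('w \<Rightarrow> 'w)"
  assumes "field F"
    and "subfield (carrier K) F"
    and "K = F\<lparr>carrier := carrier K\<rparr>"
    and "algebraically_closed K"
    and "algebra_functor K Fo Fm"
    and "extension_invariant K Fo Fm"
    and "algebra_functor K Go Gm"
    and "extension_invariant K Go Gm"
    and "vdim K (Fo (self_algebra K)) <o |carrier K|"
    and "vdim K (Go (self_algebra K)) <o |carrier K|"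
  shows "nalg_isomorphic K (Fo (self_algebra K)) (Go (self_algebra K)) \<longleftrightarrow>
         nalg_isomorphic F (Fo (self_algebra F)) (Go (self_algebra F))"
proof -
  interpret F: field F by fact
  have K_field: "field K" using F.subfield_iff(2)[OF assms(2)] assms(3) by simp
  interpret K: field K by fact
  have F_calg: "self_algebra F \<in> calg K"
    using algebra_self_algebra[OF F.is_cring subfieldE(1)[OF assms(2)]] F.one_not_zero assms(3)
    by (simp add: calg_def self_algebra_def)
  have "K\<lparr>carrier := carrier K\<rparr> = K" by simp
  then have K_calg: "self_algebra K \<in> calg K"
    using algebra_self_algebra[OF K.is_cring K.carrier_is_subring] K.one_not_zero
    by (simp add: calg_def self_algebra_def)
  have ext: "\<exists>\<tau>. scalar_extension F K (Ho (self_algebra K)) (Ho (self_algebra F)) \<tau>"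
    if H: "algebra_functor K Ho Hm" "extension_invariant K Ho Hm"
    for Ho :: "('u, 'u) module \<Rightarrow> ('u, 'x) module" and Hm
  proof -
    obtain t where "\<forall>R\<in>calg K. t R \<in> nalg_iso R (Ho R) (tensor_algebra K (Ho (self_algebra K)) R)"
      using H(2) unfolding extension_invariant_def by blast
    then have "t (self_algebra F) \<in> nalg_iso F (Ho (self_algebra F)) (tensor_algebra K (Ho (self_algebra K)) (self_algebra F))"
      using F_calg nalg_iso_self_algebra by metis
    moreover have "nonassoc_algebra K (Ho (self_algebra K))" "nonassoc_algebra F (Ho (self_algebra F))"
      using algebra_functor.Fo_algebra[OF H(1)] F_calg K_calg nonassoc_algebra_self_algebra_scalars
        F.is_cring K.is_cring by blast+
    ultimately show ?thesis using assms(1-3) scalar_extension.intro by blast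
  qed
  obtain \<tau> where "scalar_extension F K (Fo (self_algebra K)) (Fo (self_algebra F)) \<tau>" using ext assms(5,6) by blast
  moreover obtain \<tau>' where "scalar_extension F K (Go (self_algebra K)) (Go (self_algebra F)) \<tau>'" using ext assms(7,8) by blast
  ultimately interpret two_extensions F K "Fo (self_algebra K)" "Fo (self_algebra F)" \<tau> "Go (self_algebra K)" "Go (self_algebra F)" \<tau>'
    by (rule two_extensions.intro)
  show ?thesis using iso_extends iso_descends[OF assms(4,9,10)] by blast
qed

end
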